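(* Let $R$ be a rule set belonging to the Simion class, and let $\Delta_n=\Delta_n(R)$ for $n\ge0$ (assumed to be triangulations of $\partial P_n$ for $n\ge1$). Let $F(\widehat{\mathcal F},x,y,z)=\sum_{n\ge0}\sum_{\sigma} x^{\mathrm{fw}(\sigma)}y^{\mathrm{bw}(\sigma)}z^n$, the inner sum over saturated faces $\sigma$ of $\Delta_n$. If pairs of type $THTH$ nest and pairs of type $HTHT$ do not nest, then $$F(\widehat{\mathcal F},x,y,z)=\frac{C(yz(z+1))+z}{1+z}+\frac{xz\,(1+zC(yz(z+1)))\,C(yz(z+1))^2}{(1+z)\,(1-2C(yz(z+1))xz-C(yz(z+1))^2xz^2)}.$$ If pairs of type $THTH$ do not nest and pairs of type $HTHT$ nest, then $$F(\widehat{\mathcal F},x,y,z)=\frac{C(xz(z+1))+z}{1+z}+\frac{yz\,(1+zC(xz(z+1)))\,C(xz(z+1))^2}{(1+z)\,(1-2C(xz(z+1))yz-C(xz(z+1))^2yz^2)}.$$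
   Context: $P_n$ is the convex hull of $e_j-e_i$ ($i\ne j$) in $\mathbb{R}^{n+1}$. An arrow $(i,j)$, $i\ne j\in\{1,\dots,n+1\}$, has tail $i$, head $j$; it is forward if $i<j$, backward if $i>j$; $V_n$ is the set of arrows ($V_0=\emptyset$). For two arrows with four distinct endpoints $p_1<\dots<p_4$, the type is the $T/H$ word recording whether $p_1,\dots,p_4$ are tails or heads; the two tails and two heads can be matched in two ways; for types $THTH,HTHT$ one matching nests (joins $\{p_1,p_4\},\{p_2,p_3\}$), for $THHT,HTTH$ one crosses (joins $\{p_1,p_3\},\{p_2,p_4\}$), for $TTHH,HHTT$ one nests and the other crosses. A rule set $R$ chooses for each of the six types which of the two matchings is an edge ("nests"/"does not nest", "crosses"/"does not cross", "nests"/"crosses"). $\Delta_n(R)$ is the flag complex on $V_n$ whose edges are: pairs of distinct arrows with a common tail, pairs with a common head, and pairs with four distinct endpoints equal to the matching chosen by $R$ for their type; $\Delta_0=\{\emptyset\}$. The Simion class: exactly one of $THTH$, $HTHT$ nests, and if both $THHT$ and $HTTH$ cross then both $TTHH$ and $HHTT$ nest. For a face $\sigma$, $\mathrm{fw}(\sigma)$, $\mathrm{bw}(\sigma)$ are its numbers of forward and backward arrows. For $n\ge1$ a set $\sigma\subseteq V_n$ is saturated if the set of endpoints of its arrows is $\{1,\dots,n+1\}$; the empty subset of $V_0$ is saturated. $C(u)=\sum_{n\ge0}C_nu^n=\frac{1-\sqrt{1-4u}}{2u}$ is the Catalan generating function. *)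

theory Defs
  imports
    "HOL-Analysis.Analysis"
    "HOL-Analysis.Finite_Function_Topology"
    "HOL-Computational_Algebra.Formal_Power_Series"
begin

section \<open>Arrows and the polytope\<close>

text \<open>The arrow with tail \<open>i\<close> and head \<open>j\<close> is the pair \<open>(i, j)\<close>.\<close>

type_synonym arrow = "nat \<times> nat"

definition tail :: "arrow \<Rightarrow> nat" where "tail a = fst a"
definition head :: "arrow \<Rightarrow> nat" where "head a = snd a"
definition endpoints :: "arrow \<Rightarrow> nat set" where "endpoints a = {tail a, head a}"

definition forward :: "arrow \<Rightarrow> bool" where "forward a \<longleftrightarrow> tail a < head a"
definition backward :: "arrow \<Rightarrow> bool" where "backward a \<longleftrightarrow> tail a > head a"

definition arrows :: "nat \<Rightarrow> arrow set" where
  "arrows n = {(i, j). i \<in> {1..n + 1} \<and> j \<in> {1..n + 1} \<and> i \<noteq> j}"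

text \<open>
  Since \<open>n\<close> varies, all the spaces \<open>\<real>\<^sup>n\<^sup>+\<^sup>1\<close> are realised inside the normed space of finitely
  supported functions \<open>nat \<Rightarrow>\<^sub>0 real\<close>, with \<open>e\<^sub>i\<close> the unit vector at \<open>i\<close>.  The boundary of the polytope is
  its relative frontier, which depends only on its affine hull and not on the ambient space.
\<close>

definition unit_vec :: "nat \<Rightarrow> nat \<Rightarrow>\<^sub>0 real" where
  "unit_vec i = Poly_Mapping.single i 1"

definition vertex :: "arrow \<Rightarrow> nat \<Rightarrow>\<^sub>0 real" where
  "vertex a = unit_vec (head a) - unit_vec (tail a)"

definition root_polytope :: "nat \<Rightarrow> (nat \<Rightarrow>\<^sub>0 real) set" where
  "root_polytope n = convex hull (vertex ` arrows n)"

text \<open>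
  Geometric triangulation: the abstract complex \<open>K\<close>, realised by \<open>a \<mapsto> vertex a\<close>, is a geometric
  simplicial complex whose underlying space is the boundary of the polytope.  (The library constant
  \<open>triangulation\<close> is restricted to types of class \<open>euclidean_space\<close>, so with one fixed dimension.)
\<close>

definition triangulates_boundary :: "nat \<Rightarrow> arrow set set \<Rightarrow> bool" where
  "triangulates_boundary n K \<longleftrightarrow>
     (\<forall>\<sigma>\<in>K. \<sigma> \<subseteq> arrows n \<and> inj_on vertex \<sigma> \<and> \<not> affine_dependent (vertex ` \<sigma>)) \<and>
     (\<forall>\<sigma>\<in>K. \<forall>\<tau>. \<tau> \<subseteq> \<sigma> \<longrightarrow> \<tau> \<in> K) \<and>
     (\<forall>\<sigma>\<in>K. \<forall>\<tau>\<in>K. convex hull (vertex ` \<sigma>) \<inter> convex hull (vertex ` \<tau>)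
                        = convex hull (vertex ` (\<sigma> \<inter> \<tau>))) \<and>
     (\<Union>\<sigma>\<in>K. convex hull (vertex ` \<sigma>)) = rel_frontier (root_polytope n)"


section \<open>Rule sets and the flag complexes\<close>

datatype end_kind = T | H

datatype matching = Nesting | Crossing | Separated

abbreviation "THTH \<equiv> [T, H, T, H]"
abbreviation "HTHT \<equiv> [H, T, H, T]"
abbreviation "THHT \<equiv> [T, H, H, T]"
abbreviation "HTTH \<equiv> [H, T, T, H]"
abbreviation "TTHH \<equiv> [T, T, H, H]"
abbreviation "HHTT \<equiv> [H, H, T, T]"

text \<open>The next two are meaningful for arrows with four distinct endpoints \<open>p\<^sub>1 < p\<^sub>2 < p\<^sub>3 < p\<^sub>4\<close>
  (\<open>ps ! 0\<close> to \<open>ps ! 3\<close>).\<close>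

definition pair_type :: "arrow \<Rightarrow> arrow \<Rightarrow> end_kind list" where
  "pair_type a b =
     map (\<lambda>p. if p \<in> {tail a, tail b} then T else H) (sorted_list_of_set (endpoints a \<union> endpoints b))"

definition pair_matching :: "arrow \<Rightarrow> arrow \<Rightarrow> matching" where
  "pair_matching a b =
     (let ps = sorted_list_of_set (endpoints a \<union> endpoints b) in
      if {endpoints a, endpoints b} = {{ps ! 0, ps ! 3}, {ps ! 1, ps ! 2}} then Nesting
      else if {endpoints a, endpoints b} = {{ps ! 0, ps ! 2}, {ps ! 1, ps ! 3}} then Crossing
      else Separated)"

text \<open>
  A rule set gives, for each type, the matching that forms an edge.  ``Does not nest'' for
  \<open>THTH\<close>, \<open>HTHT\<close> and ``does not cross'' for \<open>THHT\<close>, \<open>HTTH\<close> both mean that the edge is the matching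
  joining \<open>p\<^sub>1, p\<^sub>2\<close> and \<open>p\<^sub>3, p\<^sub>4\<close>.  Values at other words are irrelevant.
\<close>

definition rule_set :: "(end_kind list \<Rightarrow> matching) \<Rightarrow> bool" where
  "rule_set R \<longleftrightarrow>
     R THTH \<in> {Nesting, Separated} \<and> R HTHT \<in> {Nesting, Separated} \<and>
     R THHT \<in> {Crossing, Separated} \<and> R HTTH \<in> {Crossing, Separated} \<and>
     R TTHH \<in> {Nesting, Crossing} \<and> R HHTT \<in> {Nesting, Crossing}"

definition simion_class :: "(end_kind list \<Rightarrow> matching) \<Rightarrow> bool" where
  "simion_class R \<longleftrightarrow>
     ((R THTH = Nesting) \<noteq> (R HTHT = Nesting)) \<and>
     (R THHT = Crossing \<and> R HTTH = Crossing \<longrightarrow> R TTHH = Nesting \<and> R HHTT = Nesting)"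

definition edge :: "(end_kind list \<Rightarrow> matching) \<Rightarrow> arrow \<Rightarrow> arrow \<Rightarrow> bool" where
  "edge R a b \<longleftrightarrow>
     a \<noteq> b \<and>
     (tail a = tail b \<or> head a = head b \<or>
      card (endpoints a \<union> endpoints b) = 4 \<and> pair_matching a b = R (pair_type a b))"

definition flag_complex :: "(end_kind list \<Rightarrow> matching) \<Rightarrow> nat \<Rightarrow> arrow set set" where
  "flag_complex R n = {\<sigma>. \<sigma> \<subseteq> arrows n \<and> (\<forall>a\<in>\<sigma>. \<forall>b\<in>\<sigma>. a \<noteq> b \<longrightarrow> edge R a b)}"


section \<open>Generating functions\<close>

definition fw :: "arrow set \<Rightarrow> nat" where "fw \<sigma> = card {a \<in> \<sigma>. forward a}"
definition bw :: "arrow set \<Rightarrow> nat" where "bw \<sigma> = card {a \<in> \<sigma>. backward a}"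

definition saturated :: "nat \<Rightarrow> arrow set \<Rightarrow> bool" where
  "saturated n \<sigma> \<longleftrightarrow>
     \<sigma> \<subseteq> arrows n \<and> (if n = 0 then \<sigma> = {} else (\<Union>a\<in>\<sigma>. endpoints a) = {1..n + 1})"

text \<open>
  Power series in \<open>x, y, z\<close> are elements of \<open>\<rat>[[x]][[y]][[z]]\<close>.  All denominators below have constant
  coefficient 1 in \<open>z\<close>, for which the library division is multiplication by the inverse.
\<close>

definition var_x :: "rat fps fps fps" where "var_x = fps_const (fps_const fps_X)"
definition var_y :: "rat fps fps fps" where "var_y = fps_const fps_X"
definition var_z :: "rat fps fps fps" where "var_z = fps_X"

lemma divide_mult_unit:
  fixes f g :: "rat fps fps fps"
  assumes "fps_nth g 0 = 1"
  shows "f / g * g = f"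
proof -
  have "subdegree g = 0" using assms by simp
  hence "unit_factor g = g" by (simp add: fps_unit_factor_def)
  hence "f / g = f * inverse g"
    using \<open>subdegree g = 0\<close> by (simp add: fps_divide_def)
  moreover have "inverse (1 :: rat fps fps) = 1"
    by (simp add: fps_inverse_one')
  hence "g * inverse g = 1"
    using fps_right_inverse[of g 1] assms by (simp add: fps_inverse_def)
  ultimately show ?thesis by (simp add: mult_ac)
qed

text \<open>The coefficient of \<open>z\<^sup>n\<close> is an element of \<open>\<rat>[[x]][[y]]\<close>, in which \<open>x\<close> is \<open>fps_const fps_X\<close>
  and \<open>y\<close> is \<open>fps_X\<close>.\<close>

definition saturated_gf :: "(end_kind list \<Rightarrow> matching) \<Rightarrow> rat fps fps fps" where
  "saturated_gf R = Abs_fps (\<lambda>n.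
     \<Sum>\<sigma> | \<sigma> \<in> flag_complex R n \<and> saturated n \<sigma>. fps_const fps_X ^ fw \<sigma> * fps_X ^ bw \<sigma>)"

definition catalan_fps :: "'a::comm_ring_1 fps" where
  "catalan_fps = Abs_fps (\<lambda>n. of_nat ((2 * n choose n) div (n + 1)))"

lemma catalan_number_Suc:
  "(n + 2) * ((2 * Suc n choose Suc n) div (Suc n + 1)) =
   2 * (2 * n + 1) * ((2 * n choose n) div (n + 1))"
proof -
  have dvd: "(k + 1) dvd (2 * k choose k)" for k
  proof -
    have "(k + 1) * (2 * k choose (k + 1)) = k * (2 * k choose k)"
    proof -
      have "2 * k - k = k" by simp
      thus ?thesis
        using binomial_absorb_comp[of "2 * k" k] binomial_absorption[of k "2 * k"]
        unfolding Suc_eq_plus1 by metis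
    qed
    hence "(k + 1) dvd k * (2 * k choose k)" by (metis dvd_triv_left)
    moreover have "coprime (k + 1) k" by simp
    ultimately show ?thesis by (simp add: coprime_dvd_mult_right_iff)
  qed
  define b where "b = (2 * n choose n)"
  define c where "c = b div (n + 1)"
  have b: "b = (n + 1) * c" using dvd[of n] unfolding b_def c_def by (metis dvd_mult_div_cancel)
  have "(n + 2) * ((2 * Suc n choose Suc n) div (Suc n + 1)) = (2 * Suc n choose Suc n)"
    using dvd[of "Suc n"] by (metis Suc_eq_plus1 add_2_eq_Suc' dvd_mult_div_cancel)
  moreover have "(n + 1) * (2 * Suc n choose Suc n) = (n + 1) * (2 * (2 * n + 1) * c)"
  proof -
    have "Suc n * (2 * Suc n choose Suc n) = 2 * (Suc n * (Suc (2 * n) choose n))"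
      using binomial_absorption[of n "2 * Suc n"] by simp
    also have "Suc n * (Suc (2 * n) choose n) = Suc (2 * n) * b"
      using binomial_absorb_comp[of "Suc (2 * n)" n] by (simp add: b_def)
    finally show ?thesis using b by (simp add: algebra_simps del: binomial_Suc_Suc)
  qed
  hence "(2 * Suc n choose Suc n) = 2 * (2 * n + 1) * c"
    by (metis add_is_0 mult_cancel1 one_neq_zero)
  ultimately show ?thesis unfolding c_def b_def by simp
qed

text \<open>The closed form \<open>2 u C(u) = 1 - (1 - 4 u)\<^sup>1\<^sup>/\<^sup>2\<close>.\<close>

lemma catalan_fps_closed_form:
  "2 * fps_X * catalan_fps = 1 - (fps_binomial (1 / 2 :: 'a::field_char_0) oo (fps_const (- 4) * fps_X))"
proof -
  have key: "((1 / 2 :: 'a) gchoose Suc n) * (- 4) ^ Suc n = - 2 * of_nat ((2 * n choose n) div (n + 1))" for n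
  proof (induction n)
    case 0
    show ?case by simp
  next
    case (Suc n)
    define g where "g = (1 / 2 :: 'a) gchoose Suc n"
    define c where "c = (of_nat ((2 * n choose n) div (n + 1)) :: 'a)"
    define c' where "c' = (of_nat ((2 * Suc n choose Suc n) div (Suc n + 1)) :: 'a)"
    have nz: "(of_nat n + 2 :: 'a) \<noteq> 0"
      using of_nat_neq_0[of "Suc n", where ?'a = 'a] by (simp add: add.commute)
    have "of_nat (n + 2) * c' = of_nat (2 * (2 * n + 1)) * c"
      unfolding c_def c'_def of_nat_mult[symmetric] catalan_number_Suc ..
    hence 1: "(of_nat n + 2) * c' = 2 * (2 * of_nat n + 1) * c"
      by (simp add: algebra_simps)
    have "of_nat (Suc (Suc n)) * ((1 / 2 :: 'a) gchoose Suc (Suc n)) = (1 / 2 - of_nat (Suc n)) * g"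
      unfolding g_def gbinomial_absorption gbinomial_absorb_comp ..
    hence 2: "(of_nat n + 2) * ((1 / 2 :: 'a) gchoose Suc (Suc n)) = (1 / 2 - of_nat (Suc n)) * g"
      by (simp add: algebra_simps)
    have 3: "(1 / 2 - of_nat (Suc n)) * (- 4) = 2 * (2 * of_nat n + 1 :: 'a)"
      by (simp add: field_simps)
    have IH: "g * (- 4) ^ Suc n = - 2 * c" using Suc.IH unfolding g_def c_def .
    have "(of_nat n + 2) * (((1 / 2 :: 'a) gchoose Suc (Suc n)) * (- 4) ^ Suc (Suc n))
            = (1 / 2 - of_nat (Suc n)) * (- 4) * (g * (- 4) ^ Suc n)"
      unfolding mult.assoc[symmetric] 2 by (simp only: power_Suc mult_ac)
    also have "\<dots> = - 2 * (2 * (2 * of_nat n + 1) * c)"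
      unfolding IH 3 by (simp only: mult_ac)
    also have "\<dots> = (of_nat n + 2) * (- 2 * c')"
      unfolding 1[symmetric] by (simp only: mult_ac)
    finally have "((1 / 2 :: 'a) gchoose Suc (Suc n)) * (- 4) ^ Suc (Suc n) = - 2 * c'"
      using mult_left_cancel[OF nz] by blast
    thus ?case unfolding c'_def .
  qed
  show ?thesis
  proof (rule fps_ext)
    fix n
    have two: "2 * fps_X * (catalan_fps :: 'a fps) = fps_X * (fps_const 2 * catalan_fps)"
      by (simp add: numeral_fps_const mult_ac)
    show "fps_nth (2 * fps_X * catalan_fps) n =
      fps_nth (1 - (fps_binomial (1 / 2 :: 'a) oo (fps_const (- 4) * fps_X))) n"
    proof (cases n)
      case 0
      thus ?thesis by (simp add: two)
    next
      case (Suc m)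
      show ?thesis
        using key[of m] unfolding Suc two
        by (simp add: catalan_fps_def fps_compose_linear mult.commute[of "_ ^ _"]
            del: binomial_Suc_Suc power_Suc)
    qed
  qed
qed

definition Cat :: "'a::comm_ring_1 fps \<Rightarrow> 'a fps" where
  "Cat u = catalan_fps oo u"

end

theory Submission
  imports Defs
begin

text \<open>
  Give the arrows of a saturated face positive integer weights, and record at each node the
  out-weight minus the in-weight.  As the complex triangulates the boundary, and the vertices of a
  face are unimodular (a face is a forest), this is a bijection between weighted saturated faces and
  lists of \<open>n + 1\<close> nonzero integers with sum 0.  If \<open>THTH\<close> nests, the rules of the Simion class force
  a gap between neighbouring nodes over which all forward arrows and no backward arrow pass, so the
  total forward weight is the maximal prefix sum of the list.  Hence, whatever the other rules are,
  the sum of \<open>(X / (1 - X))\<^sup>f\<^sup>w (Y / (1 - Y))\<^sup>b\<^sup>w\<close> over saturated faces counts closed walks with nonzero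
  steps by their maximum and their total ascent.  Cutting a walk where it first attains its maximum
  and peeling unit steps off the two parts gives linear recursions with a geometric solution, and
  the substitution \<open>X = x / (1 + x)\<close>, \<open>Y = y / (1 + y)\<close> yields the formula.  The other case follows by
  reversing all arrows.
\<close>

section \<open>Ring homomorphisms on power series and the Catalan series\<close>

text \<open>The faces depend on the rules, the lattice points they carry do not: a nonzero integer
  vector with sum 0 lies on the boundary of exactly one dilate of the polytope, the dilation factor
  being the sum of its positive entries, and there in the relative interior of exactly one face. No
  node of a face is both a tail and a head, so contributions at a node never cancel: the face is
  saturated iff no entry vanishes, and the total weight is the sum of the positive entries. The
  obstacle is to read off from the vector how this total splits into forward and backward weight;
  prefix sums do it, being forward minus backward weight over a gap. A weight ranging over 1, 2, ...
  gives one arrow the series X / (1 - X), and X = x / (1 + x) undoes this. The walk recursions do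
  not run from smaller to larger depth only, since peeling an up-step leads to greater depth; their
  solution is pinned down by the exponents of the series instead. A geometric solution leads to a
  quadratic equation for its ratio, and the root that is a power series is where the Catalan series
  comes from.\<close>

definition is_hom :: "('a::comm_ring_1 \<Rightarrow> 'b::comm_ring_1) \<Rightarrow> bool" where
  "is_hom h \<longleftrightarrow> h 1 = 1 \<and> (\<forall>a b. h (a + b) = h a + h b) \<and> (\<forall>a b. h (a * b) = h a * h b)"

lemma hom_one: "is_hom h \<Longrightarrow> h 1 = 1"
  and hom_add: "is_hom h \<Longrightarrow> h (a + b) = h a + h b"
  and hom_mult: "is_hom h \<Longrightarrow> h (a * b) = h a * h b"
  by (auto simp: is_hom_def)

lemma hom_zero: "is_hom h \<Longrightarrow> h 0 = 0"
  by (metis add_cancel_left_left hom_add)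

lemma hom_diff: "is_hom h \<Longrightarrow> h (a - b) = h a - h b"
  by (metis add_diff_cancel diff_add_cancel hom_add)

lemma hom_power: "is_hom h \<Longrightarrow> h (a ^ k) = h a ^ k"
  by (induction k) (simp_all add: hom_one hom_mult)

lemma hom_sum: "is_hom h \<Longrightarrow> h (sum f A) = (\<Sum>a\<in>A. h (f a))"
  by (induction A rule: infinite_finite_induct) (simp_all add: hom_zero hom_add)

text \<open>Coefficientwise maps, substitutions and the interchange of variables are all treated as
  ring homomorphisms, so that a polynomial identity is carried through a change of variables by
  rewriting.\<close>

lemmas hom_simps = hom_one hom_add hom_mult hom_zero hom_diff hom_power hom_sum

lemma is_hom_comp: "is_hom g \<Longrightarrow> is_hom h \<Longrightarrow> is_hom (\<lambda>a. g (h a))"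
  by (simp add: is_hom_def)

lemma is_hom_fps_const: "is_hom fps_const"
  by (simp add: is_hom_def)

lemma is_hom_compose: "fps_nth c 0 = 0 \<Longrightarrow> is_hom (\<lambda>f. f oo (c :: 'a::idom fps))"
  by (simp add: is_hom_def fps_compose_add_distrib fps_compose_mult_distrib)

definition map_fps :: "('a::comm_ring_1 \<Rightarrow> 'b::comm_ring_1) \<Rightarrow> 'a fps \<Rightarrow> 'b fps" where
  "map_fps h f = Abs_fps (\<lambda>n. h (fps_nth f n))"

lemma map_fps_nth [simp]: "fps_nth (map_fps h f) n = h (fps_nth f n)"
  by (simp add: map_fps_def)

lemma is_hom_map_fps:
  assumes h: "is_hom h" shows "is_hom (map_fps h)"
  unfolding is_hom_def
  by (auto simp: fps_eq_iff fps_mult_nth hom_simps[OF h] fps_one_nth)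

lemma map_fps_X: "is_hom h \<Longrightarrow> map_fps h fps_X = fps_X"
  by (simp add: fps_eq_iff fps_X_nth hom_simps)

lemma map_fps_const: "is_hom h \<Longrightarrow> map_fps h (fps_const c) = fps_const (h c)"
  by (simp add: fps_eq_iff hom_simps)

definition swap_fps :: "'a::comm_ring_1 fps fps \<Rightarrow> 'a fps fps" where
  "swap_fps f = Abs_fps (\<lambda>j. Abs_fps (\<lambda>i. fps_nth (fps_nth f i) j))"

lemma swap_fps_nth [simp]: "fps_nth (fps_nth (swap_fps f) j) i = fps_nth (fps_nth f i) j"
  by (simp add: swap_fps_def)

lemma is_hom_swap_fps: "is_hom swap_fps"
  unfolding is_hom_def
proof (intro conjI allI)
  show "swap_fps 1 = (1 :: 'a fps fps)"
    by (intro fps_ext) (simp add: fps_one_nth)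
  fix f g :: "'a fps fps"
  show "swap_fps (f + g) = swap_fps f + swap_fps g"
    by (intro fps_ext) simp
  show "swap_fps (f * g) = swap_fps f * swap_fps g"
    by (intro fps_ext) (simp add: fps_mult_nth fps_sum_nth, subst sum.swap, simp)
qed

lemma swap_fps_X: "swap_fps fps_X = fps_const fps_X"
  and swap_fps_const_X: "swap_fps (fps_const fps_X) = fps_X"
  by (intro fps_ext; simp add: fps_X_nth)+

text \<open>With s the square root of 1 - 4 u, the closed form 2 u C = 1 - s squares to 4 u (u C^2 -
  C + 1) = 0, and 4 u cancels.\<close>

lemma catalan_fps_eq_rat: "(catalan_fps :: rat fps) = 1 + fps_X * catalan_fps ^ 2"
proof -
  define s :: "rat fps" where "s = fps_binomial (1 / 2) oo (fps_const (- 4) * fps_X)"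
  define C :: "rat fps" where "C = catalan_fps"
  have "s * s = (fps_binomial (1 / 2) * fps_binomial (1 / 2)) oo (fps_const (- 4) * fps_X)"
    unfolding s_def by (subst fps_compose_mult_distrib) simp_all
  also have "fps_binomial (1 / 2) * fps_binomial (1 / 2) = (1 + fps_X :: rat fps)"
    by (simp flip: fps_binomial_add_mult add: fps_binomial_1)
  also have "(1 + fps_X :: rat fps) oo (fps_const (- 4) * fps_X) = 1 - 4 * fps_X"
    by (simp add: fps_compose_add_distrib numeral_fps_const flip: fps_const_neg)
  finally have "s * s = 1 - 4 * fps_X" .
  moreover have "2 * fps_X * C = 1 - s"
    unfolding s_def C_def by (rule catalan_fps_closed_form)
  ultimately have "4 * fps_X * (fps_X * C ^ 2 - C + 1) = 0" by algebra
  moreover have "4 * fps_X \<noteq> (0 :: rat fps)"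
    by simp
  ultimately have "fps_X * C ^ 2 - C + 1 = 0"
    by simp
  thus ?thesis
    unfolding C_def by algebra
qed

lemma fps_nth_one_plus_X_mult_square:
  "fps_nth (1 + fps_X * f ^ 2) (Suc n) = (\<Sum>i=0..n. fps_nth f i * fps_nth (f :: 'a::comm_ring_1 fps) (n - i))"
  proof -
  have "fps_nth (1 + fps_X * g) (Suc n) = fps_nth g n" for g :: "'a fps"
    by simp
  thus ?thesis unfolding power2_eq_square by (simp only: fps_mult_nth)
qed

text \<open>\<open>Cat\<close> is applied to series whose coefficients are again power series and do
  not form a field. The convolution recurrence is therefore taken from the rationals to the natural
  numbers and from there to any ring.\<close>

lemma catalan_fps_eq: "(catalan_fps :: 'a::comm_ring_1 fps) = 1 + fps_X * catalan_fps ^ 2"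
proof (rule fps_ext)
  define c where "c n = (2 * n choose n) div (n + 1)" for n
  have rec: "c (Suc n) = (\<Sum>i=0..n. c i * c (n - i))" for n
  proof -
    have "of_nat (c (Suc n)) = fps_nth (catalan_fps :: rat fps) (Suc n)"
      by (simp add: catalan_fps_def c_def)
    also have "\<dots> = of_nat (\<Sum>i=0..n. c i * c (n - i))"
      unfolding catalan_fps_eq_rat[THEN arg_cong, of "\<lambda>f. fps_nth f (Suc n)"] fps_nth_one_plus_X_mult_square
      by (simp add: catalan_fps_def c_def)
    finally show ?thesis by (simp only: of_nat_eq_iff)
  qed
  fix n
  show "fps_nth (catalan_fps :: 'a fps) n = fps_nth (1 + fps_X * catalan_fps ^ 2) n"
  proof (cases n)
    case 0 thus ?thesis by (simp add: catalan_fps_def)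
  next
    case (Suc m)
    have "fps_nth (catalan_fps :: 'a fps) n = of_nat (c (Suc m))"
      by (simp add: catalan_fps_def c_def Suc)
    also have "\<dots> = fps_nth (1 + fps_X * catalan_fps ^ 2) n"
      unfolding rec Suc fps_nth_one_plus_X_mult_square by (simp add: catalan_fps_def c_def)
    finally show ?thesis .
  qed
qed

lemma Cat_eq:
  fixes u :: "'a::idom fps"
  assumes "fps_nth u 0 = 0"
  shows "Cat u = 1 + u * Cat u ^ 2"
  using arg_cong[OF catalan_fps_eq, of "\<lambda>f. f oo u"] hom_simps[OF is_hom_compose[OF assms]] assms
  by (simp add: Cat_def)

text \<open>The difference of two solutions is annihilated by \<open>1 - u * (Cat u + C)\<close>,
  whose constant coefficient is 1.\<close>

lemma Cat_unique:
  fixes u :: "'a::idom fps"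
  assumes u: "fps_nth u 0 = 0" and C: "C = 1 + u * C ^ 2"
  shows "Cat u = C"
proof -
  have "(Cat u - C) * (1 - u * (Cat u + C)) = 0"
    using Cat_eq[OF u] C by algebra
  moreover have "fps_nth (1 - u * (Cat u + C)) 0 = 1"
    using u by simp
  hence "1 - u * (Cat u + C) \<noteq> 0" by force
  ultimately show ?thesis by simp
qed

text \<open>\<open>D\<close> and \<open>V\<close> will be the shares of the closed walks with
  maximum 0 and with positive maximum. By \<open>CD\<close>, C + z = (1 + z) (1 + D) and 1 + z C =
  (1 + z) (1 + z D), which is how the factors 1 + z enter the two denominators.\<close>

lemma gf_from_equations:
  fixes G C D V \<xi> \<eta> :: "rat fps fps fps"
  defines "z \<equiv> var_z"
  assumes C: "C = 1 + \<eta> * z * (z + 1) * C ^ 2"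
    and CD: "C = 1 + (1 + z) * D"
    and V: "V * (1 - 2 * C * \<xi> * z - C ^ 2 * \<xi> * z ^ 2) = \<xi> * z * (1 + z * D) * C ^ 2"
    and G: "G = 1 + D + V"
  shows "G = (Cat (\<eta> * z * (z + 1)) + z) / (1 + z)
             + (\<xi> * z * (1 + z * Cat (\<eta> * z * (z + 1))) * Cat (\<eta> * z * (z + 1)) ^ 2)
               / ((1 + z) * (1 - 2 * Cat (\<eta> * z * (z + 1)) * \<xi> * z
                               - Cat (\<eta> * z * (z + 1)) ^ 2 * \<xi> * z ^ 2))"
proof -
  have z0: "fps_nth z 0 = 0" by (simp add: z_def var_z_def)
  have Cat: "Cat (\<eta> * z * (z + 1)) = C"
    by (rule Cat_unique[OF _ C]) (simp add: z0)
  have *: "f / g = h" if "fps_nth g 0 = 1" "h * g = f" for f g h :: "rat fps fps fps"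
  proof -
    have "g \<noteq> 0" using that(1) by force
    thus ?thesis using divide_mult_unit[OF that(1), of f] that(2) by (metis mult_right_cancel)
  qed
  have "(C + z) / (1 + z) = 1 + D"
    by (rule *) (simp add: z0, use CD in algebra)
  moreover have "(\<xi> * z * (1 + z * C) * C ^ 2)
      / ((1 + z) * (1 - 2 * C * \<xi> * z - C ^ 2 * \<xi> * z ^ 2)) = V"
    by (rule *) (simp add: z0, use CD V in algebra)
  ultimately show ?thesis unfolding Cat G by simp
qed

section \<open>Counting walks\<close>

definition ups :: "int list \<Rightarrow> nat" where
  "ups xs = (\<Sum>x\<leftarrow>xs. nat x)"

primrec peak :: "int list \<Rightarrow> int" where
  "peak [] = 0"
| "peak (x # xs) = max 0 (x + peak xs)"

text \<open>A walk from level 0 is stored in reverse order, the head of the list being its last step; after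
  every step it is at level at most \<open>- c\<close>.\<close>

primrec low_walk :: "nat \<Rightarrow> int list \<Rightarrow> bool" where
  "low_walk c [] \<longleftrightarrow> True"
| "low_walk c (x # xs) \<longleftrightarrow> x \<noteq> 0 \<and> sum_list (x # xs) \<le> - int c \<and> low_walk c xs"

definition walks :: "nat \<Rightarrow> nat \<Rightarrow> nat \<Rightarrow> nat \<Rightarrow> int list set" where
  "walks c l k m = {xs. length xs = l \<and> low_walk c xs \<and> ups xs = k \<and> sum_list xs = - int m}"

definition down_walks :: "nat \<Rightarrow> nat \<Rightarrow> nat \<Rightarrow> nat \<Rightarrow> int list set" where
  "down_walks c l k m = {xs \<in> walks c l k m. xs \<noteq> [] \<and> hd xs < 0}"

definition up_walks :: "nat \<Rightarrow> nat \<Rightarrow> nat \<Rightarrow> nat \<Rightarrow> int list set" where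
  "up_walks c l k m = {xs \<in> walks c l k m. xs \<noteq> [] \<and> hd xs > 0}"

lemma ups_simps [simp]: "ups [] = 0" "ups (x # xs) = nat x + ups xs"
  by (simp_all add: ups_def)

lemma ups_append [simp]: "ups (xs @ ys) = ups xs + ups ys"
  by (simp add: ups_def)

lemma ups_rev [simp]: "ups (rev xs) = ups xs"
  by (induction xs) simp_all

lemma ups_uminus: "int (ups (map uminus xs)) = int (ups xs) - sum_list xs"
  by (induction xs) auto

text \<open>The bound is ascent plus descent, that is, the sum of all absolute values.\<close>

lemma abs_le_ups: "x \<in> set xs \<Longrightarrow> \<bar>x\<bar> \<le> 2 * int (ups xs) - sum_list xs"
proof (induction xs)
  case (Cons y ys)
  have "0 \<le> 2 * int (ups ys) - sum_list ys"
    by (induction ys) auto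
  with Cons show ?case by auto
qed simp

lemma finite_bounded_lists: "finite {xs. length xs = l \<and> ups xs = k \<and> sum_list xs = s}"
proof (rule finite_subset)
  show "{xs. length xs = l \<and> ups xs = k \<and> sum_list xs = s}
      \<subseteq> {xs. set xs \<subseteq> {- (2 * int k - s)..2 * int k - s} \<and> length xs = l}"
    using abs_le_ups by fastforce
qed (simp add: finite_lists_length_eq)

lemma finite_walks [simp]: "finite (walks c l k m)"
  by (rule finite_subset[OF _ finite_bounded_lists[of l k "- int m"]]) (auto simp: walks_def)

lemma finite_down_walks [simp]: "finite (down_walks c l k m)"
  and finite_up_walks [simp]: "finite (up_walks c l k m)"
  by (simp_all add: down_walks_def up_walks_def)

lemma sum_list_low_walk: "low_walk c xs \<Longrightarrow> sum_list xs \<le> 0"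
  by (cases xs) auto

lemma walks_0: "walks c 0 k m = (if k = 0 \<and> m = 0 then {[]} else {})"
  by (auto simp: walks_def)

lemma card_walks:
  "card (walks c l k m) = card (down_walks c l k m) + card (up_walks c l k m)
     + (if l = 0 \<and> k = 0 \<and> m = 0 then 1 else 0)"
proof (cases l)
  case 0
  have "down_walks c 0 k m = {}" "up_walks c 0 k m = {}"
    by (auto simp: down_walks_def up_walks_def walks_0)
  thus ?thesis by (simp add: 0 walks_0)
next
  case (Suc l')
  have "walks c l k m = down_walks c l k m \<union> up_walks c l k m"
    unfolding down_walks_def up_walks_def walks_def Suc by (auto simp: length_Suc_conv)
  moreover have "down_walks c l k m \<inter> up_walks c l k m = {}"
    by (auto simp: down_walks_def up_walks_def)
  ultimately show ?thesis by (simp add: card_Un_disjoint Suc)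
qed

lemma down_walks_empty: "down_walks c 0 k m = {}" "down_walks c l k 0 = {}"
  using sum_list_low_walk by (fastforce simp: down_walks_def walks_def neq_Nil_conv)+

lemma up_walks_empty: "up_walks c 0 k m = {}" "up_walks c l 0 m = {}" "m < c \<Longrightarrow> up_walks c l k m = {}"
  by (auto simp: up_walks_def walks_def neq_Nil_conv)

text \<open>Shortening the last step by one unit removes it if it has size one.\<close>

lemma card_down_walks_Suc:
  assumes "c \<le> 1"
  shows "card (down_walks c (Suc l) k (Suc m)) = card (down_walks c (Suc l) k m) + card (walks c l k m)"
proof -
  let ?f = "\<lambda>xs. (hd xs - 1) # tl xs"
  have "xs \<in> ?f ` down_walks c (Suc l) k m \<union> Cons (- 1) ` walks c l k m"
    if "xs \<in> down_walks c (Suc l) k (Suc m)" for xs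
  proof -
    from that obtain x r where xs: "xs = x # r" "x < 0" "length r = l" "low_walk c r"
      "ups r = k" "x + sum_list r = - 1 - int m"
      unfolding down_walks_def walks_def by (cases xs) auto
    show ?thesis
    proof (cases "x = - 1")
      case True
      thus ?thesis using xs by (auto simp: walks_def)
    next
      case False
      \<comment> \<open>The shortened step ends at level -m, which must still be at most -c. As x is
        at most -2 and the level before it at most 0, m is at least 1.\<close>
      have "c \<le> m"
        using sum_list_low_walk[OF xs(4)] xs(2,6) False assms by linarith
      hence "?f ((x + 1) # r) \<in> ?f ` down_walks c (Suc l) k m"
        using xs False by (intro imageI) (auto simp: walks_def down_walks_def)
      thus ?thesis using xs by simp
    qed
  qed
  moreover have "?f ` down_walks c (Suc l) k m \<union> Cons (- 1) ` walks c l k m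
      \<subseteq> down_walks c (Suc l) k (Suc m)"
    using assms unfolding down_walks_def walks_def by (auto simp: length_Suc_conv)
  ultimately have "down_walks c (Suc l) k (Suc m)
      = ?f ` down_walks c (Suc l) k m \<union> Cons (- 1) ` walks c l k m"
    by blast
  moreover have "?f ` down_walks c (Suc l) k m \<inter> Cons (- 1) ` walks c l k m = {}"
    by (auto simp: down_walks_def)
  moreover have "inj_on ?f (down_walks c (Suc l) k m)"
    by (rule inj_onI) (auto simp: down_walks_def intro: list.expand)
  ultimately show ?thesis
    by (simp add: card_Un_disjoint card_image)
qed

text \<open>Shortening an up-step lowers the total ascent and the final level together, so the right
  side has smaller ascent but greater depth.\<close>

lemma card_up_walks_Suc:
  assumes "c \<le> m"
  shows "card (up_walks c (Suc l) (Suc k) m)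
    = card (up_walks c (Suc l) k (Suc m)) + card (walks c l k (Suc m))"
proof -
  let ?f = "\<lambda>xs. (hd xs + 1) # tl xs"
  have "xs \<in> ?f ` up_walks c (Suc l) k (Suc m) \<union> Cons 1 ` walks c l k (Suc m)"
    if "xs \<in> up_walks c (Suc l) (Suc k) m" for xs
  proof -
    from that obtain x r where xs: "xs = x # r" "x > 0" "length r = l" "low_walk c r"
      "nat x + ups r = Suc k" "x + sum_list r = - int m"
      unfolding up_walks_def walks_def by (cases xs) auto
    show ?thesis
    proof (cases "x = 1")
      case True
      thus ?thesis using xs by (auto simp: walks_def)
    next
      case False
      hence "?f ((x - 1) # r) \<in> ?f ` up_walks c (Suc l) k (Suc m)"
        using xs False assms by (intro imageI) (auto simp: walks_def up_walks_def)
      thus ?thesis using xs by simp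
    qed
  qed
  moreover have "?f ` up_walks c (Suc l) k (Suc m) \<union> Cons 1 ` walks c l k (Suc m)
      \<subseteq> up_walks c (Suc l) (Suc k) m"
    using assms unfolding up_walks_def walks_def by (auto simp: length_Suc_conv)
  ultimately have "up_walks c (Suc l) (Suc k) m
      = ?f ` up_walks c (Suc l) k (Suc m) \<union> Cons 1 ` walks c l k (Suc m)"
    by blast
  moreover have "?f ` up_walks c (Suc l) k (Suc m) \<inter> Cons 1 ` walks c l k (Suc m) = {}"
    by (auto simp: up_walks_def)
  moreover have "inj_on ?f (up_walks c (Suc l) k (Suc m))"
    by (rule inj_onI) (auto simp: up_walks_def intro: list.expand)
  ultimately show ?thesis
    by (simp add: card_Un_disjoint card_image)
qed

text \<open>The peeling recursions have a unique solution; \<open>a\<close> and \<open>b\<close> stand for the walks ending with a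
  down-step and with an up-step, graded by the number of steps and the total ascent.\<close>

lemma card_walks_series:
  fixes a b :: "nat \<Rightarrow> rat fps fps"
  defines "z \<equiv> fps_X" and "Y \<equiv> fps_const fps_X"
  assumes c: "c \<le> 1"
    and a0: "a 0 = 0"
    and a: "\<And>m. a (Suc m) = a m + z * (a m + b m + (if m = 0 then 1 else 0))"
    and b: "\<And>m. m \<ge> c \<Longrightarrow> b m = Y * (b (Suc m) + z * (b (Suc m) + a (Suc m)))"
    and b0: "\<And>m. m < c \<Longrightarrow> b m = 0"
  shows "of_nat (card (walks c l k m)) = fps_nth (fps_nth ((if m = 0 then 1 else 0) + a m + b m) l) k"
proof -
  have a_nth: "fps_nth (fps_nth (a (Suc m)) l) k = fps_nth (fps_nth (a m) l) k +
      (case l of 0 \<Rightarrow> 0 | Suc l' \<Rightarrow> fps_nth (fps_nth (a m) l') k + fps_nth (fps_nth (b m) l') k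
         + (if m = 0 \<and> l' = 0 \<and> k = 0 then 1 else 0))" for m l k
    by (subst a) (auto simp: z_def fps_one_nth split: nat.split)
  have b_nth: "fps_nth (fps_nth (b m) l) k = (case k of 0 \<Rightarrow> 0 | Suc k' \<Rightarrow>
      fps_nth (fps_nth (b (Suc m)) l) k' + (case l of 0 \<Rightarrow> 0 | Suc l' \<Rightarrow>
         fps_nth (fps_nth (b (Suc m)) l') k' + fps_nth (fps_nth (a (Suc m)) l') k'))"
    if "m \<ge> c" for m l k
    by (subst b[OF that]) (auto simp: z_def Y_def split: nat.split)
  \<comment> \<open>Up-walks at depth m refer to depth m + 1, so they are settled for all depths at
    once by induction on the ascent k, inside the induction on the length l; down-walks are settled
    by induction on m.\<close>
  have "(\<forall>m. of_nat (card (up_walks c l k m)) = fps_nth (fps_nth (b m) l) k) \<and>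
        (\<forall>m. of_nat (card (down_walks c l k m)) = fps_nth (fps_nth (a m) l) k)" for l k
  proof (induction l arbitrary: k)
    case 0
    have "fps_nth (fps_nth (b m) 0) k = 0" for m
    proof (induction k arbitrary: m)
      case (0 m) show ?case by (cases "m < c") (auto simp: b_nth b0)
    next
      case (Suc k m) thus ?case by (cases "m < c") (auto simp: b_nth b0)
    qed
    moreover have "fps_nth (fps_nth (a m) 0) k = 0" for m
      by (induction m) (auto simp: a_nth a0)
    ultimately show ?case by (simp add: down_walks_empty up_walks_empty)
  next
    case (Suc l)
    note IH = Suc.IH
    show ?case
    proof (induction k)
      case 0
      have U: "of_nat (card (up_walks c (Suc l) 0 m)) = fps_nth (fps_nth (b m) (Suc l)) 0" for m
        by (cases "m < c") (auto simp: b_nth b0 up_walks_empty)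
      have "of_nat (card (down_walks c (Suc l) 0 m)) = fps_nth (fps_nth (a m) (Suc l)) 0" for m
        by (induction m)
           (auto simp: a_nth a0 down_walks_empty card_down_walks_Suc[OF c] card_walks IH)
      with U show ?case by blast
    next
      case (Suc k)
      have U: "of_nat (card (up_walks c (Suc l) (Suc k) m)) = fps_nth (fps_nth (b m) (Suc l)) (Suc k)" for m
        by (cases "m < c")
           (auto simp: b_nth b0 up_walks_empty card_up_walks_Suc card_walks IH Suc)
      have "of_nat (card (down_walks c (Suc l) (Suc k) m)) = fps_nth (fps_nth (a m) (Suc l)) (Suc k)" for m
        by (induction m)
           (auto simp: a_nth a0 down_walks_empty card_down_walks_Suc[OF c] card_walks IH)
      with U show ?case by blast
    qed
  qed
  thus ?thesis by (simp add: card_walks fps_one_nth add_ac)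
qed

text \<open>Closed walks, with k the ascent in excess of the maximum m: when m is the forward weight
  of a face and the ascent its total weight, k is the backward weight.\<close>

definition bridges :: "nat \<Rightarrow> nat \<Rightarrow> nat \<Rightarrow> int list set" where
  "bridges n m k = {xs. length xs = n \<and> 0 \<notin> set xs \<and> sum_list xs = 0
                        \<and> peak xs = int m \<and> ups xs = m + k}"

lemma peak_nonneg: "peak xs \<ge> 0"
  by (cases xs) auto

lemma peak_append: "peak (xs @ ys) = max (peak xs) (sum_list xs + peak ys)"
  using peak_nonneg by (induction xs) (auto simp: max_def)

lemma low_walk_0_iff: "low_walk 0 xs \<longleftrightarrow> 0 \<notin> set xs \<and> peak (rev xs) = 0"
proof (induction xs)
  case (Cons x xs)
  thus ?case using peak_nonneg[of "rev xs"] sum_list_low_walk[of 0 xs] by (auto simp: peak_append max_def)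
qed simp

lemma peak_low_walk_append:
  "low_walk 1 xs \<Longrightarrow> peak (map uminus xs @ ys) = peak ys - sum_list xs"
  using peak_nonneg[of ys] by (induction xs) auto

lemma low_walk_nonzero: "low_walk c xs \<Longrightarrow> 0 \<notin> set xs"
  by (induction xs) auto

text \<open>The cut is at the first maximum. Traversed backwards from there, the initial part is a
  walk that stays at level at most -1; its steps are the negated ones, and since walks are stored
  with the last step first, \<open>p\<close> has the entries in their original order.\<close>

lemma split_at_peak:
  "0 \<notin> set xs \<Longrightarrow> \<exists>p s. xs = map uminus p @ s \<and> low_walk 1 p \<and> peak s = 0 \<and> 0 \<notin> set s"
proof (induction xs)
  case (Cons x xs)
  then obtain p s where IH: "xs = map uminus p @ s" "low_walk 1 p" "peak s = 0" "0 \<notin> set s"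
    by auto
  show ?case
  proof (cases "peak (x # xs) = 0")
    case True
    thus ?thesis using Cons.prems by (intro exI[of _ "[]"] exI[of _ "x # xs"]) auto
  next
    case False
    hence "low_walk 1 (- x # p)"
      using IH Cons.prems by (auto simp: peak_low_walk_append max_def split: if_splits)
    thus ?thesis using IH by (intro exI[of _ "- x # p"] exI[of _ s]) auto
  qed
qed (auto intro: exI[of _ "[]"])

lemma split_at_peak_unique:
  assumes "low_walk 1 p" "low_walk 1 q" "peak s = 0" "peak t = 0"
    and "map uminus p @ s = map uminus q @ t"
  shows "p = q \<and> s = t"
  using assms
proof (induction p arbitrary: q)
  case Nil
  hence "sum_list q = 0" using peak_low_walk_append[of q t] by simp
  with Nil show ?case by (cases q) auto
next
  case (Cons x p)
  show ?case
  proof (cases q)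
    case Nil
    hence "peak t = 0 - sum_list (x # p)" using Cons.prems peak_low_walk_append[of "x # p" s] by simp
    thus ?thesis using Cons.prems by auto
  qed (use Cons in auto)
qed

text \<open>\<open>c = 1\<close> before the cut and \<open>c = 0\<close> after it express strict and
  weak inequality around the first maximum. The reversed initial part has ascent j, so the part
  itself has ascent j + m; the excess k is therefore shared as j and k - j.\<close>

lemma bridges_eq_image:
  "bridges n m k = (\<lambda>(p, s). map uminus p @ rev s) `
     (\<Union>i\<le>n. \<Union>j\<le>k. walks 1 i j m \<times> walks 0 (n - i) (k - j) m)"
proof (intro equalityI subsetI)
  fix xs assume "xs \<in> bridges n m k"
  hence xs: "length xs = n" "0 \<notin> set xs" "sum_list xs = 0" "peak xs = int m" "ups xs = m + k"
    by (auto simp: bridges_def)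
  obtain p s where ps: "xs = map uminus p @ s" "low_walk 1 p" "peak s = 0" "0 \<notin> set s"
    using split_at_peak[OF xs(2)] by blast
  have p: "sum_list p = - int m"
    using peak_low_walk_append[OF ps(2), of s] ps xs by simp
  have sp: "sum_list (map uminus p) = - sum_list p"
    by (induction p) auto
  have "p \<in> walks 1 (length p) (ups p) m"
    using ps p by (simp add: walks_def)
  moreover have "rev s \<in> walks 0 (n - length p) (k - ups p) m" "ups p \<le> k"
    using ps xs p sp ups_uminus[of p] by (auto simp: walks_def low_walk_0_iff)
  ultimately show "xs \<in> (\<lambda>(p, s). map uminus p @ rev s) `
      (\<Union>i\<le>n. \<Union>j\<le>k. walks 1 i j m \<times> walks 0 (n - i) (k - j) m)"
    using xs(1) ps(1) by (intro image_eqI[of _ _ "(p, rev s)"]) auto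
next
  fix xs assume "xs \<in> (\<lambda>(p, s). map uminus p @ rev s) `
      (\<Union>i\<le>n. \<Union>j\<le>k. walks 1 i j m \<times> walks 0 (n - i) (k - j) m)"
  then obtain p s i j where *: "xs = map uminus p @ rev s" "i \<le> n" "j \<le> k"
    "p \<in> walks 1 i j m" "s \<in> walks 0 (n - i) (k - j) m" by auto
  have sp: "sum_list (map uminus p) = - sum_list p"
    by (induction p) auto
  have "0 \<notin> set p" "0 \<notin> set s"
    using * low_walk_nonzero by (auto simp: walks_def)
  thus "xs \<in> bridges n m k"
    using * sp ups_uminus[of p]
    by (auto simp: bridges_def walks_def low_walk_0_iff peak_low_walk_append)
qed

lemma card_bridges:
  "card (bridges n m k) = (\<Sum>i\<le>n. \<Sum>j\<le>k. card (walks 1 i j m) * card (walks 0 (n - i) (k - j) m))"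
proof -
  let ?S = "\<lambda>i j. walks 1 i j m \<times> walks 0 (n - i) (k - j) m"
  have fin: "finite (?S i j)" for i j by simp
  have disj: "?S i j \<inter> ?S i j' = {}" if "j \<noteq> j'" for i j j'
    using that by (auto simp: walks_def)
  have "inj_on (\<lambda>(p, s). map uminus p @ rev s) (\<Union>i\<le>n. \<Union>j\<le>k. ?S i j)"
  proof (rule inj_onI, clarify)
    fix p s q t i j i' j'
    assume "p \<in> walks 1 i j m" "q \<in> walks 1 i' j' m"
      "s \<in> walks 0 (n - i) (k - j) m" "t \<in> walks 0 (n - i') (k - j') m"
      "map uminus p @ rev s = map uminus q @ rev t"
    thus "p = q \<and> s = t"
      using split_at_peak_unique[of p q "rev s" "rev t"] by (auto simp: walks_def low_walk_0_iff)
  qed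
  hence "card (bridges n m k) = card (\<Union>i\<le>n. \<Union>j\<le>k. ?S i j)"
    unfolding bridges_eq_image by (rule card_image)
  also have "\<dots> = (\<Sum>i\<le>n. card (\<Union>j\<le>k. ?S i j))"
    by (rule card_UN_disjoint) (use fin in auto, auto simp: walks_def)
  also have "\<dots> = (\<Sum>i\<le>n. \<Sum>j\<le>k. card (?S i j))"
    by (intro sum.cong card_UN_disjoint refl) (use fin disj in auto)
  finally show ?thesis by (simp add: card_cartesian_product)
qed

section \<open>The generating function of closed walks\<close>

text \<open>X / (1 - X), the series of one arrow with weights 1, 2, ...\<close>

definition geom :: "'a::comm_ring_1 fps" where
  "geom = Abs_fps (\<lambda>n. if n = 0 then 0 else 1)"

text \<open>The compositional inverse of \<^const>\<open>geom\<close>.\<close>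

definition alt_geom :: "'a::comm_ring_1 fps" where
  "alt_geom = Abs_fps (\<lambda>n. if n = 0 then 0 else (- 1) ^ (n - 1))"

lemma geom_eq: "geom * (1 - fps_X) = (fps_X :: 'a::comm_ring_1 fps)"
proof (rule fps_ext)
  fix n show "fps_nth (geom * (1 - fps_X)) n = fps_nth (fps_X :: 'a fps) n"
    by (cases n; cases "n - 1") (auto simp: geom_def algebra_simps)
qed

lemma alt_geom_eq: "alt_geom * (1 + fps_X) = (fps_X :: 'a::comm_ring_1 fps)"
proof (rule fps_ext)
  fix n show "fps_nth (alt_geom * (1 + fps_X)) n = fps_nth (fps_X :: 'a fps) n"
    by (cases n; cases "n - 1") (auto simp: alt_geom_def algebra_simps)
qed

lemma alt_geom_0: "fps_nth alt_geom 0 = 0"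
  by (simp add: alt_geom_def)

lemma geom_compose_alt_geom: "geom oo alt_geom = (fps_X :: 'a::idom fps)"
proof -
  have "(geom oo alt_geom) * (1 - alt_geom) = (alt_geom :: 'a fps)"
    using arg_cong[OF geom_eq[where ?'a = 'a], of "\<lambda>f. f oo alt_geom"]
    by (simp add: alt_geom_0 hom_simps[OF is_hom_compose[OF alt_geom_0]])
  hence "(geom oo alt_geom) * (1 + fps_X - alt_geom * (1 + fps_X)) = alt_geom * (1 + fps_X :: 'a fps)"
    by (metis (no_types) left_diff_distrib mult.assoc mult.commute mult_1)
  thus ?thesis unfolding alt_geom_eq by simp
qed

text \<open>The series \<open>below_gf\<close> turns out to count the closed walks that never rise above level 0, with
  exponent of \<open>z\<close> one less than the number of steps.\<close>

definition below_cat :: "rat fps fps" where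
  "below_cat = Cat (fps_const geom * fps_X * (1 + fps_X))"

definition below_gf :: "rat fps fps" where
  "below_gf = fps_const geom * fps_X * below_cat ^ 2"

lemma below_cat_eq: "below_cat = 1 + (1 + fps_X) * below_gf"
  using Cat_eq[of "fps_const geom * fps_X * (1 + fps_X) :: rat fps fps"]
  unfolding below_gf_def below_cat_def by (simp add: algebra_simps)

text \<open>The quadratic equation for \<open>below_gf\<close>, rewritten from \<open>geom\<close>
  to its variable Y by \<open>geom\<close> (1 - Y) = Y; the recursions for walks involve Y
  itself.\<close>

lemma below_gf_eq:
  "below_gf = fps_const fps_X * (fps_X + (1 + fps_X) ^ 2 * below_gf) * (1 + fps_X * below_gf)"
proof -
  have "fps_const geom * (1 - fps_const fps_X) = (fps_const fps_X :: rat fps fps)"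
    using geom_eq[where ?'a = rat] by (metis fps_const_1_eq_1 fps_const_mult fps_const_sub)
  with below_cat_eq below_gf_def show ?thesis by algebra
qed

text \<open>The factor contributed by each further level in the geometric solution of the recursions.\<close>

definition level_ratio :: "rat fps fps" where
  "level_ratio = 1 + fps_X * below_cat"

lemma level_ratio_eq: "level_ratio = (1 + fps_X) * (1 + fps_X * below_gf)"
  unfolding level_ratio_def using below_cat_eq by algebra

definition walks_gf :: "nat \<Rightarrow> nat \<Rightarrow> rat fps fps" where
  "walks_gf c m = Abs_fps (\<lambda>l. Abs_fps (\<lambda>k. of_nat (card (walks c l k m))))"

text \<open>With a and b proportional to r^m the recursions require (r - 1 - z) (1 - Y (1 + z) r) =
  Y z^2 r and b / a = (r - 1 - z) / z. \<open>level_ratio\<close> is the root r that equals 1 + z at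
  Y = 0 (the other is not a power series), and it gives b / a = (1 + z) *
  \<open>below_gf\<close>.\<close>

lemma walks_gf_1:
  "walks_gf 1 m = (if m = 0 then 1 else fps_X * level_ratio ^ (m - 1) * below_cat)"
proof -
  define a b :: "nat \<Rightarrow> rat fps fps" where
    "a m = (if m = 0 then 0 else fps_X * level_ratio ^ (m - 1))" and
    "b m = (if m = 0 then 0 else fps_X * level_ratio ^ (m - 1) * (1 + fps_X) * below_gf)" for m
  have eq: "walks_gf 1 m = (if m = 0 then 1 else 0) + a m + b m"
  proof (intro fps_ext, unfold walks_gf_def fps_nth_Abs_fps, rule card_walks_series)
    fix m
    have "fps_X * (level_ratio * p) = fps_X * p + fps_X * (fps_X * p + fps_X * p * (1 + fps_X) * below_gf)"
      for p using level_ratio_eq by algebra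
    thus "a (Suc m) = a m + fps_X * (a m + b m + (if m = 0 then 1 else 0))"
      by (cases m) (simp_all add: a_def b_def)
    have b_rec: "fps_X * p * (1 + fps_X) * below_gf = fps_const fps_X *
       (fps_X * (level_ratio * p) * (1 + fps_X) * below_gf +
        fps_X * (fps_X * (level_ratio * p) * (1 + fps_X) * below_gf + fps_X * (level_ratio * p)))"
      for p using level_ratio_eq below_gf_eq by algebra
    show "b m = fps_const fps_X * (b (Suc m) + fps_X * (b (Suc m) + a (Suc m)))" if "1 \<le> m"
      using that b_rec[of "level_ratio ^ (m - 1)"] by (cases m) (simp_all add: a_def b_def)
  qed (auto simp: a_def b_def)
  show ?thesis unfolding eq a_def b_def below_cat_eq by (simp add: algebra_simps)
qed

text \<open>The ratio is the same, but a walk may now return to level 0 by an up-step: the recursion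
  for \<open>b\<close> holds at depth 0 too, where b is \<open>fps_X * below_gf\<close>.\<close>

lemma walks_gf_0:
  "walks_gf 0 m = (if m = 0 then 1 + fps_X * below_gf
     else fps_X * (1 + fps_X * below_gf) * below_cat * level_ratio ^ (m - 1))"
proof -
  define a b :: "nat \<Rightarrow> rat fps fps" where
    "a m = (if m = 0 then 0 else fps_X * (1 + fps_X * below_gf) * level_ratio ^ (m - 1))" and
    "b m = fps_X * below_gf * level_ratio ^ m" for m
  have eq: "walks_gf 0 m = (if m = 0 then 1 else 0) + a m + b m"
  proof (intro fps_ext, unfold walks_gf_def fps_nth_Abs_fps, rule card_walks_series)
    fix m
    have "fps_X * (1 + fps_X * below_gf) * (level_ratio * p) =
        fps_X * (1 + fps_X * below_gf) * p +
        fps_X * (fps_X * (1 + fps_X * below_gf) * p + fps_X * below_gf * (level_ratio * p))"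
      for p using level_ratio_eq by algebra
    thus "a (Suc m) = a m + fps_X * (a m + b m + (if m = 0 then 1 else 0))"
      by (cases m) (simp add: a_def b_def algebra_simps, simp add: a_def b_def)
    have b_rec: "fps_X * below_gf * p = fps_const fps_X *
        (fps_X * below_gf * (level_ratio * p) +
         fps_X * (fps_X * below_gf * (level_ratio * p) + fps_X * (1 + fps_X * below_gf) * p))"
      (is "_ = ?rhs p") for p
    proof -
      have "?rhs p = fps_X * p * (fps_const fps_X * (fps_X + (1 + fps_X) ^ 2 * below_gf) * (1 + fps_X * below_gf))"
        unfolding level_ratio_eq by (simp add: algebra_simps power2_eq_square)
      thus ?thesis unfolding below_gf_eq[symmetric] by (simp add: mult_ac)
    qed
    show "b m = fps_const fps_X * (b (Suc m) + fps_X * (b (Suc m) + a (Suc m)))"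
      using b_rec[of "level_ratio ^ m"] by (simp add: a_def b_def)
  qed (auto simp: a_def b_def)
  have "fps_X * (1 + fps_X * below_gf) * p + fps_X * below_gf * (level_ratio * p)
      = fps_X * (1 + fps_X * below_gf) * below_cat * p" for p
    unfolding below_cat_eq level_ratio_eq by (simp add: algebra_simps)
  thus ?thesis unfolding eq by (cases m) (simp_all add: a_def b_def)
qed

lemma bridges_gf:
  "Abs_fps (\<lambda>n. Abs_fps (\<lambda>k. of_nat (card (bridges n m k)))) = walks_gf 1 m * walks_gf 0 m"
  by (intro fps_ext)
     (simp add: fps_mult_nth fps_sum_nth walks_gf_def card_bridges atLeast0AtMost)

text \<open>In \<open>bridge_gf\<close> the innermost variable marks the maximum and the middle one the rest of the ascent.\<close>

definition bridge_gf :: "rat fps fps fps" where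
  "bridge_gf = Abs_fps (\<lambda>n. Abs_fps (\<lambda>k. Abs_fps (\<lambda>m. of_nat (card (bridges (Suc n) m k)))))"

section \<open>Summing over the maximum of a closed walk\<close>

definition x_coeff :: "nat \<Rightarrow> rat fps fps fps \<Rightarrow> rat fps fps" where
  "x_coeff m f = map_fps (map_fps (\<lambda>g. fps_nth g m)) f"

definition x_free :: "rat fps fps \<Rightarrow> rat fps fps fps" where
  "x_free f = map_fps (map_fps fps_const) f"

lemma is_hom_x_free: "is_hom x_free"
  unfolding x_free_def [abs_def] by (intro is_hom_map_fps is_hom_fps_const)

lemma x_free_X: "x_free fps_X = var_z" "x_free (fps_const fps_X) = var_y"
  by (simp_all add: x_free_def map_fps_X map_fps_const is_hom_map_fps is_hom_fps_const var_z_def var_y_def)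

lemma x_coeff_nth: "fps_nth (fps_nth (x_coeff m f) n) k = fps_nth (fps_nth (fps_nth f n) k) m"
  by (simp add: x_coeff_def)

lemma x_free_nth: "fps_nth (fps_nth (x_free a) n) k = fps_const (fps_nth (fps_nth a n) k)"
  by (simp add: x_free_def)

lemma x_coeff_mult_x_free: "x_coeff m (x_free a * f) = a * x_coeff m f"
  by (intro fps_ext) (simp add: x_coeff_nth fps_mult_nth[of a] fps_mult_nth[of "x_free a"]
      fps_mult_nth[of "fps_nth a _"] fps_mult_nth[of "fps_nth (x_free a) _"] fps_sum_nth x_free_nth)

lemma x_coeff_simps:
  "x_coeff m (f + g) = x_coeff m f + x_coeff m g"
  "x_coeff m (f - g) = x_coeff m f - x_coeff m g"
  "x_coeff m (x_free a) = (if m = 0 then a else 0)"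
  "x_coeff 0 (var_x * f) = 0"
  "x_coeff (Suc m) (var_x * f) = x_coeff m f"
  by (intro fps_ext; simp add: x_coeff_nth x_free_nth var_x_def)+

lemma x_coeff_ext: "(\<And>m. x_coeff m f = x_coeff m g) \<Longrightarrow> f = g"
  by (simp add: x_coeff_def fps_eq_iff)

text \<open>In \<open>W\<close> the exponent of z is the number of steps, and the empty walk is
  included. For m >= 1 its coefficient of x^m is z^2 (1 + z D) C^2 r^(2 m - 2): one ratio
  \<open>r\<close> from each side of the cut gives a geometric series in
  \<open>var_x * r ^ 2\<close>. The identity is this sum with the denominator multiplied
  out.\<close>

lemma bridge_gf_eq:
  defines "D \<equiv> x_free below_gf" and "C \<equiv> x_free below_cat" and "r \<equiv> x_free level_ratio"
  shows "bridge_gf * (1 - var_x * r ^ 2)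
    = D * (1 - var_x * r ^ 2) + var_x * var_z * (1 + var_z * D) * C ^ 2"
proof -
  note h = hom_simps[OF is_hom_x_free]
  define W where "W = 1 + var_z * bridge_gf"
  have *: "z * (B * (1 - X * r ^ 2)) = z * (D * (1 - X * r ^ 2) + X * z * (1 + z * D) * C ^ 2)"
    if "1 + z * B - X * (r ^ 2 * (1 + z * B))
      = 1 + z * D - X * (r ^ 2 * (1 + z * D)) + X * (z ^ 2 * (1 + z * D) * C ^ 2)"
    for z B X r D C :: "rat fps fps fps"
  proof -
    have "z * (B * (1 - X * r ^ 2)) = (1 + z * B - X * (r ^ 2 * (1 + z * B))) - (1 - X * r ^ 2)"
      by (simp add: algebra_simps)
    also have "\<dots> = z * (D * (1 - X * r ^ 2) + X * z * (1 + z * D) * C ^ 2)"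
      unfolding that by (simp add: algebra_simps power2_eq_square)
    finally show ?thesis .
  qed
  have "bridges 0 m k = (if m = 0 \<and> k = 0 then {[]} else {})" for m k
    by (auto simp: bridges_def)
  hence "x_coeff m W = Abs_fps (\<lambda>n. Abs_fps (\<lambda>k. of_nat (card (bridges n m k))))" for m
    by (intro fps_ext) (auto simp: W_def x_coeff_def bridge_gf_def var_z_def fps_one_nth)
  hence W: "x_coeff m W = walks_gf 1 m * walks_gf 0 m" for m
    by (simp add: bridges_gf)
  have "W - var_x * (x_free (level_ratio ^ 2) * W)
      = x_free (1 + fps_X * below_gf) - var_x * (x_free (level_ratio ^ 2 * (1 + fps_X * below_gf)))
        + var_x * (x_free (fps_X ^ 2 * (1 + fps_X * below_gf) * below_cat ^ 2))" (is "?lhs = ?rhs")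
  proof (rule x_coeff_ext)
    fix m
    note simps = x_coeff_simps x_coeff_mult_x_free W walks_gf_0 walks_gf_1[unfolded One_nat_def]
    consider "m = 0" | "m = Suc 0" | i where "m = Suc (Suc i)" by (metis nat.exhaust)
    thus "x_coeff m ?lhs = x_coeff m ?rhs"
    proof cases
      case 1
      show ?thesis unfolding 1 by (simp add: simps)
    next
      case 2
      show ?thesis unfolding 2 by (simp add: simps, simp add: power2_eq_square mult_ac)
    next
      case (3 i)
      show ?thesis unfolding 3 by (simp add: simps, simp add: power2_eq_square mult_ac)
    qed
  qed
  hence "var_z * (bridge_gf * (1 - var_x * r ^ 2))
    = var_z * (D * (1 - var_x * r ^ 2) + var_x * var_z * (1 + var_z * D) * C ^ 2)"
    unfolding W_def D_def C_def r_def h x_free_X by (rule *)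
  moreover have "var_z \<noteq> 0" by (simp add: var_z_def)
  ultimately show ?thesis using mult_left_cancel by blast
qed

text \<open>Both variables t are replaced by t / (1 + t), the inner one coefficientwise and the
  outer one by composition. This sends the weight series t / (1 - t) of an arrow to t.\<close>

definition weight_subst :: "rat fps fps \<Rightarrow> rat fps fps" where
  "weight_subst f = map_fps (\<lambda>g. g oo alt_geom) f oo alt_geom"

lemma is_hom_weight_subst: "is_hom weight_subst"
  unfolding weight_subst_def [abs_def]
  by (intro is_hom_comp[OF is_hom_compose[OF alt_geom_0]] is_hom_map_fps is_hom_compose alt_geom_0)

lemma weight_subst_const: "weight_subst (fps_const f) = fps_const (f oo alt_geom)"
  by (simp add: weight_subst_def map_fps_const is_hom_compose alt_geom_0)

lemma weight_subst_map_const: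
  "weight_subst (map_fps fps_const f) = map_fps fps_const f oo alt_geom"
proof -
  have "map_fps (\<lambda>g. g oo alt_geom) (map_fps fps_const f) = map_fps fps_const (f :: rat fps)"
    by (simp add: fps_eq_iff)
  thus ?thesis by (simp add: weight_subst_def)
qed

lemma weight_subst_geom:
  "weight_subst (fps_const geom) = fps_const fps_X" "weight_subst geom = fps_X"
proof -
  show "weight_subst (fps_const geom) = fps_const fps_X"
    by (simp add: weight_subst_const geom_compose_alt_geom)
  have "map_fps fps_const (geom :: rat fps) = geom"
    by (simp add: fps_eq_iff geom_def)
  thus "weight_subst geom = fps_X"
    by (metis weight_subst_map_const geom_compose_alt_geom)
qed

text \<open>Multiplying by 1 + x turns the denominator 1 - X (1 + z C)^2, where X = x / (1 + x),
  into 1 - 2 C x z - C^2 x z^2.\<close>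

lemma bridge_gf_subst:
  obtains C D V where "C = 1 + var_y * var_z * (var_z + 1) * C ^ 2" "C = 1 + (1 + var_z) * D"
    "V * (1 - 2 * C * var_x * var_z - C ^ 2 * var_x * var_z ^ 2)
      = var_x * var_z * (1 + var_z * D) * C ^ 2"
    "map_fps weight_subst bridge_gf = D + V"
proof -
  define E where "E = map_fps weight_subst"
  have E: "is_hom E" unfolding E_def by (intro is_hom_map_fps is_hom_weight_subst)
  note h = hom_simps[OF E] hom_simps[OF is_hom_x_free]
  define C where "C = E (x_free below_cat)"
  define D where "D = E (x_free below_gf)"
  define X where "X = E var_x"
  have z: "E var_z = var_z"
    by (simp add: E_def var_z_def map_fps_X is_hom_weight_subst)
  have y: "E (x_free (fps_const geom)) = var_y"
  proof -
    have "map_fps fps_const (geom :: rat fps) = geom"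
      by (simp add: fps_eq_iff geom_def)
    thus ?thesis
      by (simp add: E_def x_free_def map_fps_const is_hom_map_fps is_hom_fps_const
          is_hom_weight_subst weight_subst_geom var_y_def)
  qed
  have X: "X * (1 + var_x) = var_x"
  proof -
    have "X = fps_const (fps_const alt_geom)"
      by (simp add: X_def E_def var_x_def map_fps_const is_hom_weight_subst weight_subst_const alt_geom_0)
    thus ?thesis
      using alt_geom_eq[where ?'a = rat]
      by (simp add: var_x_def flip: fps_const_1_eq_1)
  qed
  have C: "C = 1 + (1 + var_z) * D"
    unfolding C_def D_def by (subst below_cat_eq) (simp add: h x_free_X z)
  have D: "D = var_y * var_z * C ^ 2"
    unfolding C_def D_def by (subst below_gf_def) (simp add: h x_free_X z y)
  have r: "E (x_free level_ratio) = 1 + var_z * C"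
    unfolding C_def level_ratio_def by (simp add: h x_free_X z)
  have "E (bridge_gf * (1 - var_x * x_free level_ratio ^ 2)) =
      E (x_free below_gf * (1 - var_x * x_free level_ratio ^ 2)
         + var_x * var_z * (1 + var_z * x_free below_gf) * x_free below_cat ^ 2)"
    by (simp only: bridge_gf_eq)
  hence W: "E bridge_gf * (1 - X * (1 + var_z * C) ^ 2)
      = D * (1 - X * (1 + var_z * C) ^ 2) + X * var_z * (1 + var_z * D) * C ^ 2"
    by (simp add: h r z flip: C_def D_def X_def)
  define V where "V = E bridge_gf - D"
  have "V * (1 - 2 * C * var_x * var_z - C ^ 2 * var_x * var_z ^ 2)
      = var_x * var_z * (1 + var_z * D) * C ^ 2"
    using W X unfolding V_def by algebra
  moreover have "C = 1 + var_y * var_z * (var_z + 1) * C ^ 2"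
    using C D by algebra
  ultimately show ?thesis using that C unfolding V_def E_def by (metis add_diff_cancel_left' diff_add_cancel)
qed

section \<open>Faces of the flag complexes\<close>

lemma sorted_list_of_four:
  fixes a b c d :: nat
  assumes "a < b" "b < c" "c < d"
  shows "sorted_list_of_set {a, b, c, d} = [a, b, c, d]"
  using sorted_list_of_set.idem_if_sorted_distinct[of "[a, b, c, d]"] assms by simp

text \<open>In each shape the type is read off p < q < r < s, and the named matching is the one that
  e and f realise. Used contrapositively: a rule choosing the other matching excludes the shape from
  faces.\<close>

lemma edge_config:
  assumes "edge R e f" "p < q" "q < r" "r < (s :: nat)"
  shows "e = (p, q) \<Longrightarrow> f = (r, s) \<Longrightarrow> R THTH = Separated"
    and "e = (q, r) \<Longrightarrow> f = (s, p) \<Longrightarrow> R HTHT = Nesting"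
    and "e = (q, s) \<Longrightarrow> f = (r, p) \<Longrightarrow> R HTTH = Crossing"
    and "e = (p, r) \<Longrightarrow> f = (s, q) \<Longrightarrow> R THHT = Crossing"
    and "e = (p, r) \<Longrightarrow> f = (q, s) \<Longrightarrow> R TTHH = Crossing"
    and "e = (r, p) \<Longrightarrow> f = (s, q) \<Longrightarrow> R HHTT = Crossing"
  using assms sorted_list_of_four[OF assms(2-4)]
  by (auto simp: edge_def pair_matching_def pair_type_def endpoints_def tail_def head_def
      insert_commute doubleton_eq_iff)

text \<open>A path has at most three nodes, and a common tail or head in addition would make one of
  the arrows a loop.\<close>

lemma edge_no_path:
  assumes "edge R a b" "tail a \<noteq> head a" "tail b \<noteq> head b"
  shows "tail a \<noteq> head b" "head a \<noteq> tail b"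
proof -
  have *: "card {u, v, w} \<noteq> 4" for u v w :: nat
    by (simp add: card_insert_if)
  show "tail a \<noteq> head b" "head a \<noteq> tail b"
    using assms *[of "tail a" "head a" "tail b"] *[of "tail a" "head a" "head b"]
    by (auto simp: edge_def endpoints_def insert_commute)
qed

lemma face_edge: "\<sigma> \<in> flag_complex R n \<Longrightarrow> a \<in> \<sigma> \<Longrightarrow> b \<in> \<sigma> \<Longrightarrow> a \<noteq> b \<Longrightarrow> edge R a b"
  by (simp add: flag_complex_def)

text \<open>Hence every node of a face is purely a tail or purely a head, which rules out
  cancellation in \<open>excess\<close>.\<close>

lemma face_no_path:
  assumes "\<sigma> \<in> flag_complex R n" "a \<in> \<sigma>" "b \<in> \<sigma>"
  shows "head a \<noteq> tail b"
proof (cases "a = b")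
  case True
  thus ?thesis using assms by (auto simp: flag_complex_def arrows_def head_def tail_def)
next
  case False
  have "tail a \<noteq> head a" "tail b \<noteq> head b"
    using assms by (auto simp: flag_complex_def arrows_def head_def tail_def)
  thus ?thesis using edge_no_path(2)[OF face_edge[OF assms False]] by simp
qed

text \<open>With \<open>s\<close> the last tail and \<open>t\<close> the first head of the forward arrows, the gap is the one after \<open>s\<close>
  or before \<open>t\<close> if \<open>HTTH\<close> or \<open>THHT\<close> does not cross.  If both cross, then \<open>(s, t)\<close> is an arrow because
  \<open>TTHH\<close> nests, and backward arrows covering all gaps between \<open>s\<close> and \<open>t\<close> would cross each other.\<close>

lemma forward_gap:
  assumes R: "rule_set R" "simion_class R" "R THTH = Nesting"
    and \<sigma>: "\<sigma> \<in> flag_complex R n"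
    and ex: "\<exists>a\<in>\<sigma>. forward a"
  obtains p where "\<And>a. a \<in> \<sigma> \<Longrightarrow> forward a \<Longrightarrow> tail a \<le> p \<and> p < head a"
    and "\<And>a. a \<in> \<sigma> \<Longrightarrow> backward a \<Longrightarrow> \<not> (head a \<le> p \<and> p < tail a)"
proof -
  define F where "F = {a \<in> \<sigma>. forward a}"
  have fin\<sigma>: "finite \<sigma>"
    by (rule finite_subset[of _ "{1..n + 1} \<times> {1..n + 1}"])
       (use \<sigma> in \<open>auto simp: flag_complex_def arrows_def\<close>)
  hence "finite F" "F \<noteq> {}" using ex by (auto simp: F_def)
  have ne: "i \<noteq> l" if "(i, j) \<in> \<sigma>" "(k, l) \<in> \<sigma>" for i j k l
    using face_no_path[OF \<sigma> that(2,1)] by (simp add: head_def tail_def)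
  have e: "edge R (i, j) (k, l)" if "(i, j) \<in> \<sigma>" "(k, l) \<in> \<sigma>" "i \<noteq> k" for i j k l
    using face_edge[OF \<sigma> that(1,2)] that(3) by auto
  \<comment> \<open>\<open>no_sep\<close> is the rule for THTH. In the Simion class HTHT then does
    not nest, so by \<open>no_nest\<close> no forward arrow lies strictly inside a backward
    one.\<close>
  have no_sep: "\<not> (i < j \<and> j < k \<and> k < l)" if "(i, j) \<in> \<sigma>" "(k, l) \<in> \<sigma>" for i j k l
    using edge_config(1)[of R "(i, j)" "(k, l)" i j k l] e[of i j k l] that R(3) by auto
  have no_nest: "\<not> (l < i \<and> i < j \<and> j < k)" if "(i, j) \<in> \<sigma>" "(k, l) \<in> \<sigma>" for i j k l
    using edge_config(2)[of R "(i, j)" "(k, l)" l i j k] e[of i j k l] that R(2,3)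
    by (auto simp: simion_class_def)
  define s where "s = Max (tail ` F)"
  define t where "t = Min (head ` F)"
  have "s \<in> tail ` F" "t \<in> head ` F"
    using \<open>finite F\<close> \<open>F \<noteq> {}\<close> by (simp_all add: s_def t_def)
  then obtain u r where su: "(s, u) \<in> \<sigma>" "s < u" and rt: "(r, t) \<in> \<sigma>" "r < t"
    by (auto simp: F_def forward_def head_def tail_def)
  have F: "i \<le> s" "t \<le> j" if "(i, j) \<in> \<sigma>" "i < j" for i j
  proof -
    have "i \<in> tail ` F" "j \<in> head ` F"
      using that by (force simp: F_def forward_def head_def tail_def)+
    thus "i \<le> s" "t \<le> j"
      using \<open>finite F\<close> by (simp_all add: s_def t_def)
  qed
  have "r \<le> s" "t \<le> u" using F su rt by auto
  \<comment> \<open>Otherwise (r, t) and (s, u) would be separated forward arrows.\<close>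
  have "s < t"
    using no_sep[OF rt(1) su(1)] ne[OF su(1) rt(1)] su(2) rt(2) by linarith
  have "\<exists>p. s \<le> p \<and> p < t \<and> (\<forall>(i, j)\<in>\<sigma>. j < i \<longrightarrow> \<not> (j \<le> p \<and> p < i))"
  proof -
    consider "R HTTH \<noteq> Crossing" | "R THHT \<noteq> Crossing" | "R TTHH = Nesting" "R HHTT = Nesting"
      using R(2) by (auto simp: simion_class_def)
    thus ?thesis
    proof cases
      case 1
      \<comment> \<open>A backward arrow over the gap after s starts before u, and then crosses (s,
        u) in type HTTH, or after u, and then contains (s, u). The next case is its mirror image
        with (r, t).\<close>
      have False if "(i, j) \<in> \<sigma>" "j \<le> s" "s < i" for i j
        using edge_config(3)[of R "(s, u)" "(i, j)" j s i u] e[OF su(1) that(1)] 1 su(2) that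
          ne[OF su(1) that(1)] ne[OF that(1) su(1)] no_nest[OF su(1) that(1)]
        by (cases "i < u") auto
      thus ?thesis using \<open>s < t\<close> by blast
    next
      case 2
      have False if "(i, j) \<in> \<sigma>" "j \<le> t - 1" "t - 1 < i" for i j
      proof -
        have "j < t" "t < i" "r \<noteq> j"
          using that(2,3) rt(2) ne[OF rt(1) that(1)] ne[OF that(1) rt(1)] by linarith+
        thus False
          using edge_config(4)[of R "(r, t)" "(i, j)" r j t i] e[OF rt(1) that(1)] 2 rt(2)
            no_nest[OF rt(1) that(1)]
          by (cases "r < j") auto
      qed
      thus ?thesis using \<open>s < t\<close> by (intro exI[of _ "t - 1"]) fastforce
    next
      case 3
      have st: "(s, t) \<in> \<sigma>"
      proof (rule ccontr)
        assume "(s, t) \<notin> \<sigma>"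
        hence "r < s" "t < u" using su rt \<open>r \<le> s\<close> \<open>t \<le> u\<close> by (auto simp: le_less)
        thus False
          using edge_config(5)[of R "(r, t)" "(s, u)" r s t u] e[OF rt(1) su(1)] \<open>s < t\<close> 3 by auto
      qed
      show ?thesis
      proof (rule ccontr)
        assume "\<not> ?thesis"
        hence cover: "\<exists>i j. (i, j) \<in> \<sigma> \<and> j \<le> p \<and> p < i" if "s \<le> p" "p < t" for p
          using that by (metis (mono_tags, lifting) case_prodI2)
        define B where "B = {a \<in> \<sigma>. head a \<le> s \<and> s < tail a}"
        have "finite B" using fin\<sigma> by (simp add: B_def)
        moreover have "B \<noteq> {}"
          using cover[of s] \<open>s < t\<close> by (force simp: B_def head_def tail_def)
        ultimately have "Max (tail ` B) \<in> tail ` B" by simp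
        then obtain c d where cd: "(c, d) \<in> \<sigma>" "d \<le> s" "s < c" "c = Max (tail ` B)"
          by (auto simp: B_def head_def tail_def)
        have max: "i \<le> c" if "(i, j) \<in> \<sigma>" "j \<le> s" "s < i" for i j
          unfolding cd(4) using that \<open>finite B\<close>
          by (intro Max_ge) (force simp: B_def head_def tail_def)+
        have "d < s" using cd ne[OF su(1) cd(1)] by linarith
        \<comment> \<open>(c, d) reaches farthest right among the backward arrows over the gap after
          s, yet stops before t since it may not contain (s, t). The arrow covering the gap after c
          must then begin its span beyond s, and it crosses (c, d) in type HHTT.\<close>
        have "c < t"
          using no_nest[OF st cd(1)] ne[OF cd(1) st] \<open>d < s\<close> \<open>s < t\<close> by linarith
        then obtain i j where ij: "(i, j) \<in> \<sigma>" "j \<le> c" "c < i"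
          using cover[of c] cd by auto
        have "s < j" using max[OF ij(1)] ij cd ne[OF su(1) ij(1)] by linarith
        moreover have "j < c" using ij ne[OF cd(1) ij(1)] by linarith
        ultimately show False
          using edge_config(6)[of R "(c, d)" "(i, j)" d j c i] e[OF cd(1) ij(1)] \<open>d < s\<close> ij 3 by auto
      qed
    qed
  qed
  then obtain p where p: "s \<le> p" "p < t" "\<forall>(i, j)\<in>\<sigma>. j < i \<longrightarrow> \<not> (j \<le> p \<and> p < i)" by blast
  show ?thesis
  proof
    fix a assume "a \<in> \<sigma>" "forward a"
    thus "tail a \<le> p \<and> p < head a"
      using F[of "fst a" "snd a"] p by (auto simp: forward_def tail_def head_def)
  next
    fix a assume "a \<in> \<sigma>" "backward a"
    thus "\<not> (head a \<le> p \<and> p < tail a)"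
      using p(3) by (auto simp: backward_def tail_def head_def)
  qed
qed

section \<open>Maximum and ascent of the list of a weighted face\<close>

lemma finite_arrows [simp]: "finite (arrows n)"
  by (rule finite_subset[of _ "{1..n + 1} \<times> {1..n + 1}"]) (auto simp: arrows_def)

text \<open>This is minus the \<open>q\<close>-th coordinate of the weighted sum of vertices, so that prefix sums give the
  net forward weight passing over a gap.\<close>

definition excess :: "nat \<Rightarrow> (arrow \<Rightarrow> nat) \<Rightarrow> nat \<Rightarrow> int" where
  "excess n w q = (\<Sum>a\<in>arrows n. (if tail a = q then int (w a) else 0) - (if head a = q then int (w a) else 0))"

definition excess_list :: "nat \<Rightarrow> (arrow \<Rightarrow> nat) \<Rightarrow> int list" where
  "excess_list n w = map (excess n w) [1..<n + 2]"

definition supp :: "(arrow \<Rightarrow> nat) \<Rightarrow> arrow set" where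
  "supp w = {a. w a > 0}"

lemma length_excess_list [simp]: "length (excess_list n w) = n + 1"
  by (simp add: excess_list_def)

lemma prefix_le_peak: "sum_list (take i xs) \<le> peak xs"
proof (induction xs arbitrary: i)
  case (Cons x xs)
  show ?case
  proof (cases i)
    case (Suc j)
    thus ?thesis using Cons[of j] by simp
  qed (simp add: peak_nonneg)
qed simp

lemma peak_attained: "\<exists>i\<le>length xs. peak xs = sum_list (take i xs)"
proof (induction xs)
  case (Cons x xs)
  then obtain i where i: "i \<le> length xs" "peak xs = sum_list (take i xs)" by blast
  show ?case
  proof (cases "0 \<le> x + peak xs")
    case True
    thus ?thesis using i by (intro exI[of _ "Suc i"]) auto
  qed (auto intro: exI[of _ 0])
qed simp

lemma sum_excess:
  assumes "i \<le> n + 1"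
  shows "sum_list (take i (excess_list n w)) =
    (\<Sum>a\<in>arrows n. (if tail a \<le> i then int (w a) else 0) - (if head a \<le> i then int (w a) else 0))"
proof -
  have "sum_list (take i (excess_list n w)) = (\<Sum>q\<in>{1..<i + 1}. excess n w q)"
    using assms unfolding excess_list_def
    by (simp add: take_map take_upt interv_sum_list_conv_sum_set_nat del: upt_Suc)
  also have "\<dots> = (\<Sum>a\<in>arrows n. \<Sum>q\<in>{1..<i + 1}.
      (if tail a = q then int (w a) else 0) - (if head a = q then int (w a) else 0))"
    unfolding excess_def by (rule sum.swap)
  also have "\<dots> = (\<Sum>a\<in>arrows n. (if tail a \<le> i then int (w a) else 0) - (if head a \<le> i then int (w a) else 0))"
    by (intro sum.cong) (auto simp: sum_subtractf arrows_def tail_def head_def)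
  finally show ?thesis .
qed

lemma sum_excess_list: "sum_list (excess_list n w) = 0"
proof -
  have "sum_list (take (n + 1) (excess_list n w)) = 0"
    unfolding sum_excess[OF order_refl]
    by (intro sum.neutral) (auto simp: arrows_def tail_def head_def)
  thus ?thesis by (simp add: excess_list_def)
qed

lemma peak_excess_list:
  assumes R: "rule_set R" "simion_class R" "R THTH = Nesting"
    and w: "supp w \<in> flag_complex R n"
  shows "peak (excess_list n w) = int (\<Sum>a | a \<in> arrows n \<and> forward a. w a)"
proof (rule antisym)
  let ?M = "\<Sum>a\<in>arrows n. if forward a then int (w a) else 0"
  have M: "int (\<Sum>a | a \<in> arrows n \<and> forward a. w a) = ?M"
    by (simp add: sum.If_cases Int_def)
  show "peak (excess_list n w) \<le> int (\<Sum>a | a \<in> arrows n \<and> forward a. w a)"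
  proof -
    obtain i where "i \<le> n + 1" "peak (excess_list n w) = sum_list (take i (excess_list n w))"
      using peak_attained[of "excess_list n w"] by auto
    thus ?thesis
      unfolding M by (auto simp: sum_excess forward_def intro!: sum_mono)
  qed
  show "int (\<Sum>a | a \<in> arrows n \<and> forward a. w a) \<le> peak (excess_list n w)"
  proof (cases "\<exists>a\<in>supp w. forward a")
    case False
    hence "?M = 0" by (intro sum.neutral) (auto simp: supp_def)
    thus ?thesis unfolding M using peak_nonneg by simp
  next
    case True
    then obtain p where p: "\<And>a. a \<in> supp w \<Longrightarrow> forward a \<Longrightarrow> tail a \<le> p \<and> p < head a"
      "\<And>a. a \<in> supp w \<Longrightarrow> backward a \<Longrightarrow> \<not> (head a \<le> p \<and> p < tail a)"
      using forward_gap[OF R w] by metis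
    have "supp w \<subseteq> arrows n" using w by (simp add: flag_complex_def)
    with True p(1) have "p \<le> n + 1"
      by (fastforce simp: arrows_def head_def)
    hence "sum_list (take p (excess_list n w)) = ?M"
      unfolding sum_excess[OF \<open>p \<le> n + 1\<close>]
    proof (intro sum.cong refl)
      fix a assume "a \<in> arrows n"
      show "(if tail a \<le> p then int (w a) else 0) - (if head a \<le> p then int (w a) else 0)
        = (if forward a then int (w a) else 0)"
      proof (cases "a \<in> supp w")
        case True
        thus ?thesis using p[OF True] by (auto simp: forward_def backward_def)
      qed (simp add: supp_def)
    qed
    thus ?thesis unfolding M using prefix_le_peak[of p "excess_list n w"] by simp
  qed
qed

text \<open>At every node of a face either the out-weight or the in-weight vanishes, so the positive
  part of the excess is the out-weight; each arrow has one tail.\<close>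

lemma ups_excess_list:
  assumes w: "supp w \<in> flag_complex R n"
  shows "ups (excess_list n w) = (\<Sum>a\<in>arrows n. w a)"
proof -
  have nat_excess: "nat (excess n w q) = (\<Sum>a\<in>arrows n. if tail a = q then w a else 0)" for q
  proof (cases "\<exists>a\<in>supp w. tail a = q")
    case True
    hence "excess n w q = (\<Sum>a\<in>arrows n. if tail a = q then int (w a) else 0)"
      unfolding excess_def using face_no_path[OF w] by (intro sum.cong) (auto simp: supp_def)
    also have "\<dots> = int (\<Sum>a\<in>arrows n. if tail a = q then w a else 0)"
      unfolding of_nat_sum by (intro sum.cong) auto
    finally show ?thesis by (simp only: nat_int)
  next
    case False
    have *: "w a = 0" if "tail a = q" for a
  proof -
    have "a \<notin> supp w" using that False by blast
    thus ?thesis by (simp add: supp_def)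
  qed
    have "excess n w q \<le> 0"
      unfolding excess_def by (rule sum_nonpos) (simp add: *)
    moreover have "(\<Sum>a\<in>arrows n. if tail a = q then w a else 0) = 0"
      by (rule sum.neutral) (simp add: *)
    ultimately show ?thesis by simp
  qed
  have "ups (excess_list n w) = (\<Sum>q\<in>{1..<n + 2}. nat (excess n w q))"
    by (simp add: ups_def excess_list_def interv_sum_list_conv_sum_set_nat o_def del: upt_Suc)
  also have "\<dots> = (\<Sum>a\<in>arrows n. \<Sum>q\<in>{1..<n + 2}. if tail a = q then w a else 0)"
    unfolding nat_excess by (rule sum.swap)
  also have "\<dots> = (\<Sum>a\<in>arrows n. w a)"
    by (intro sum.cong) (auto simp: arrows_def tail_def)
  finally show ?thesis .
qed

section \<open>Weighted faces and lattice points\<close>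

lemma lookup_scaleR: "Poly_Mapping.lookup (r *\<^sub>R x) i = r *\<^sub>R Poly_Mapping.lookup x i"
proof -
  have "finite {i. r *\<^sub>R Poly_Mapping.lookup x i \<noteq> 0}"
    by (rule finite_subset[OF _ finite_lookup[of x]]) auto
  thus ?thesis by (simp add: scaleR_poly_mapping_def lookup_Abs_poly_mapping)
qed

lemma lookup_unit_vec: "Poly_Mapping.lookup (unit_vec i) q = (if q = i then 1 else 0)"
  by (simp add: unit_vec_def lookup_single when_def)

lemma lookup_vertex:
  "Poly_Mapping.lookup (vertex a) q = (if head a = q then 1 else 0) - (if tail a = q then 1 else 0)"
  by (auto simp: vertex_def lookup_minus lookup_unit_vec)

lemmas lookup_simps = lookup_scaleR lookup_sum lookup_vertex lookup_unit_vec lookup_add lookup_minus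

text \<open>A transport plan from the negative part m of v to its positive part p: the product
  weights m(i) p(j) have the right marginals. They vanish for i = j because m and p have disjoint
  supports, so only arrows occur.\<close>

lemma balanced_point_in_root_polytope:
  fixes v :: "nat \<Rightarrow> real"
  assumes bal: "(\<Sum>q\<in>{1..n + 1}. v q) = 0" and one: "(\<Sum>q\<in>{1..n + 1}. max 0 (v q)) = 1"
  shows "(\<Sum>q\<in>{1..n + 1}. v q *\<^sub>R unit_vec q) \<in> root_polytope n"
proof -
  define N where "N = {1..n + 1}"
  define p m where "p q = max 0 (v q)" and "m q = max 0 (- v q)" for q
  have v: "v q = p q - m q" for q by (auto simp: p_def m_def)
  have p1: "sum p N = 1" using one by (simp add: p_def N_def)
  have "sum p N - sum m N = 0" using bal by (simp only: v sum_subtractf N_def)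
  hence m1: "sum m N = 1" using p1 by simp
  define w where "w a = m (tail a) * p (head a)" for a
  have w0: "w (i, i) = 0" for i by (auto simp: w_def p_def m_def tail_def head_def)
  have sub: "arrows n \<subseteq> N \<times> N" "\<And>a. a \<in> N \<times> N - arrows n \<Longrightarrow> w a = 0"
    using w0 by (auto simp: arrows_def N_def)
  have fin: "finite N" by (simp add: N_def)
  have "sum w (arrows n) = sum w (N \<times> N)"
    by (rule sum.mono_neutral_left) (use sub fin in auto)
  also have "\<dots> = sum m N * sum p N"
    by (simp add: w_def tail_def head_def sum_product sum.cartesian_product case_prod_unfold)
  finally have sum_w: "sum w (arrows n) = 1" by (simp add: p1 m1)
  have "(\<Sum>a\<in>arrows n. w a *\<^sub>R vertex a) = (\<Sum>a\<in>N \<times> N. w a *\<^sub>R vertex a)"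
    by (rule sum.mono_neutral_left) (use sub fin in auto)
  also have "\<dots> = (\<Sum>i\<in>N. \<Sum>j\<in>N. (m i * p j) *\<^sub>R unit_vec j - (m i * p j) *\<^sub>R unit_vec i)"
    by (simp add: w_def tail_def head_def sum.cartesian_product case_prod_unfold vertex_def
        scaleR_diff_right)
  also have "\<dots> = (\<Sum>j\<in>N. (sum m N * p j) *\<^sub>R unit_vec j) - (\<Sum>i\<in>N. (m i * sum p N) *\<^sub>R unit_vec i)"
    unfolding sum_subtractf sum_distrib_left sum_distrib_right scaleR_sum_left
    by (subst sum.swap) (rule refl)
  also have "\<dots> = (\<Sum>q\<in>N. v q *\<^sub>R unit_vec q)"
    unfolding p1 m1 by (simp add: v scaleR_diff_left sum_subtractf)
  finally have eq: "(\<Sum>a\<in>arrows n. w a *\<^sub>R vertex a) = (\<Sum>q\<in>N. v q *\<^sub>R unit_vec q)" .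
  have "(\<Sum>a\<in>arrows n. w a *\<^sub>R vertex a) \<in> root_polytope n"
    unfolding root_polytope_def
    by (rule convex_sum) (auto simp: sum_w hull_inc, auto simp: w_def p_def m_def)
  thus ?thesis unfolding eq N_def .
qed

text \<open>The sum of the coordinates in the positive support of v is a linear functional that is
  at most 1 on the polytope and equal to 1 at the point, so no t x with t > 1 belongs to the
  polytope.\<close>

lemma balanced_point_in_rel_frontier:
  fixes v :: "nat \<Rightarrow> real"
  assumes "n \<ge> 1"
    and bal: "(\<Sum>q\<in>{1..n + 1}. v q) = 0" and one: "(\<Sum>q\<in>{1..n + 1}. max 0 (v q)) = 1"
  shows "(\<Sum>q\<in>{1..n + 1}. v q *\<^sub>R unit_vec q) \<in> rel_frontier (root_polytope n)"
proof -
  define N where "N = {1..n + 1}"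
  define x where "x = (\<Sum>q\<in>N. v q *\<^sub>R unit_vec q)"
  define J where "J = {q \<in> N. v q > 0}"
  define \<phi> :: "(nat \<Rightarrow>\<^sub>0 real) \<Rightarrow> real" where "\<phi> y = (\<Sum>q\<in>J. Poly_Mapping.lookup y q)" for y
  have "finite J" "finite N" by (simp_all add: J_def N_def)
  have x_in: "x \<in> root_polytope n"
    unfolding x_def N_def by (rule balanced_point_in_root_polytope[OF bal one])
  have lin: "\<phi> (r *\<^sub>R y + s *\<^sub>R y') = r * \<phi> y + s * \<phi> y'" for r s y y'
    by (simp add: \<phi>_def lookup_simps sum.distrib sum_distrib_left)
  have "convex {y. \<phi> y \<le> 1}"
  proof (rule convexI)
    fix y y' :: "nat \<Rightarrow>\<^sub>0 real" and r s :: real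
    assume *: "y \<in> {y. \<phi> y \<le> 1}" "y' \<in> {y. \<phi> y \<le> 1}" "0 \<le> r" "0 \<le> s" "r + s = 1"
    have "r * \<phi> y + s * \<phi> y' \<le> r * 1 + s * 1"
      using * by (intro add_mono mult_left_mono) auto
    thus "r *\<^sub>R y + s *\<^sub>R y' \<in> {y. \<phi> y \<le> 1}" using * by (simp add: lin)
  qed
  moreover have "vertex a \<in> {y. \<phi> y \<le> 1}" for a
    using \<open>finite J\<close> by (simp add: \<phi>_def lookup_simps sum_subtractf)
  ultimately have half: "root_polytope n \<subseteq> {y. \<phi> y \<le> 1}"
    unfolding root_polytope_def by (intro hull_minimal) auto
  have "\<phi> x = (\<Sum>q\<in>J. v q)"
    unfolding \<phi>_def x_def by (rule sum.cong) (use \<open>finite N\<close> in \<open>auto simp: lookup_simps J_def if_distrib cong: if_cong\<close>)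
  also have "\<dots> = (\<Sum>q\<in>N. max 0 (v q))"
    by (rule sum.mono_neutral_cong_left) (use \<open>finite N\<close> in \<open>auto simp: J_def\<close>)
  finally have \<phi>x: "\<phi> x = 1" using one by (simp add: N_def)
  have "x \<notin> rel_interior (root_polytope n)"
  proof
    assume "x \<in> rel_interior (root_polytope n)"
    then obtain U where U: "open U" "x \<in> U" "U \<inter> affine hull root_polytope n \<subseteq> root_polytope n"
      unfolding rel_interior by blast
    have "open ((\<lambda>t. t *\<^sub>R x) -` U)"
      by (rule open_vimage[OF U(1)]) (intro continuous_intros)
    moreover have "1 \<in> (\<lambda>t. t *\<^sub>R x) -` U" using U(2) by simp
    ultimately obtain e where e: "e > 0" "ball 1 e \<subseteq> (\<lambda>t. t *\<^sub>R x) -` U"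
      using open_contains_ball by blast
    define t where "t = 1 + e / 2"
    have t: "t > 1" "t *\<^sub>R x \<in> U"
      using e by (auto simp: t_def dist_real_def subset_iff)
    \<comment> \<open>Opposite vertices have midpoint 0. Once 0 is in the affine hull, so are all
      multiples of x, and the point t x in \<open>U\<close> gives the contradiction.\<close>
    have arr: "(1, 2) \<in> arrows n" "(2, 1) \<in> arrows n"
      using \<open>n \<ge> 1\<close> by (auto simp: arrows_def)
    have "vertex (1, 2) \<in> root_polytope n" "vertex (2, 1) \<in> root_polytope n"
      using arr by (auto simp: root_polytope_def hull_inc)
    hence "(1 / 2) *\<^sub>R vertex (1, 2) + (1 / 2) *\<^sub>R vertex (2, 1) \<in> affine hull root_polytope n"
      by (intro mem_affine[OF affine_affine_hull]) (auto simp: hull_inc)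
    moreover have "(1 / 2) *\<^sub>R vertex (1, 2) + (1 / 2) *\<^sub>R vertex (2, 1) = 0"
      by (simp add: vertex_def head_def tail_def flip: scaleR_add_right)
    ultimately have "0 \<in> affine hull root_polytope n" by simp
    hence "(1 - t) *\<^sub>R 0 + t *\<^sub>R x \<in> affine hull root_polytope n"
      using x_in by (intro mem_affine[OF affine_affine_hull]) (auto simp: hull_inc)
    hence "t *\<^sub>R x \<in> root_polytope n" using U(3) t(2) by auto
    hence "\<phi> (t *\<^sub>R x + 0 *\<^sub>R x) \<le> 1" using half by auto
    thus False using t(1) unfolding lin \<phi>x by simp
  qed
  thus ?thesis
    using x_in closure_subset[of "root_polytope n"] unfolding rel_frontier_def x_def N_def by auto
qed

section \<open>Barycentric coordinates in the triangulation\<close>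

lemma affine_independent_coeffs:
  assumes "finite \<sigma>" "inj_on vertex \<sigma>" "\<not> affine_dependent (vertex ` \<sigma>)"
    and "(\<Sum>a\<in>\<sigma>. c a) = 0" "(\<Sum>a\<in>\<sigma>. c a *\<^sub>R vertex a) = 0" "a \<in> \<sigma>"
  shows "c a = 0"
proof (rule ccontr)
  assume "c a \<noteq> 0"
  define U where "U x = c (inv_into \<sigma> vertex x)" for x
  have U: "U (vertex b) = c b" if "b \<in> \<sigma>" for b
    using that assms(2) by (simp add: U_def)
  have "sum U (vertex ` \<sigma>) = 0" "(\<Sum>x\<in>vertex ` \<sigma>. U x *\<^sub>R x) = 0"
    using assms(2,4,5) U by (simp_all add: sum.reindex cong: sum.cong)
  moreover have "\<exists>x\<in>vertex ` \<sigma>. U x \<noteq> 0" using U[OF assms(6)] assms(6) \<open>c a \<noteq> 0\<close> by (metis imageI)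
  ultimately show False
    using assms(1,3) affine_dependent_explicit_finite[of "vertex ` \<sigma>"] by blast
qed

lemma convex_hull_vertices:
  assumes "finite \<sigma>" "inj_on vertex \<sigma>" "x \<in> convex hull (vertex ` \<sigma>)"
  obtains u where "\<And>a. a \<in> \<sigma> \<Longrightarrow> u a \<ge> 0" "sum u \<sigma> = 1" "(\<Sum>a\<in>\<sigma>. u a *\<^sub>R vertex a) = x"
proof -
  obtain u where "\<forall>y\<in>vertex ` \<sigma>. u y \<ge> 0" "sum u (vertex ` \<sigma>) = 1" "(\<Sum>y\<in>vertex ` \<sigma>. u y *\<^sub>R y) = x"
    using assms(3) convex_hull_finite[of "vertex ` \<sigma>"] assms(1) by auto
  thus ?thesis
    using assms(2) by (intro that[of "u \<circ> vertex"]) (auto simp: sum.reindex)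
qed

lemma triangulation_face:
  assumes "triangulates_boundary n K" "\<sigma> \<in> K"
  shows "finite \<sigma>" "inj_on vertex \<sigma>" "\<not> affine_dependent (vertex ` \<sigma>)"
proof -
  have "\<forall>\<sigma>\<in>K. \<sigma> \<subseteq> arrows n \<and> inj_on vertex \<sigma> \<and> \<not> affine_dependent (vertex ` \<sigma>)"
    using assms(1) unfolding triangulates_boundary_def by (elim conjE)
  hence "\<sigma> \<subseteq> arrows n \<and> inj_on vertex \<sigma> \<and> \<not> affine_dependent (vertex ` \<sigma>)"
    using assms(2) by simp
  thus "finite \<sigma>" "inj_on vertex \<sigma>" "\<not> affine_dependent (vertex ` \<sigma>)"
    by (auto intro: finite_subset)
qed

lemma triangulation_hull_Int:
  assumes "triangulates_boundary n K" "\<sigma> \<in> K" "\<tau> \<in> K"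
  shows "convex hull (vertex ` \<sigma>) \<inter> convex hull (vertex ` \<tau>) = convex hull (vertex ` (\<sigma> \<inter> \<tau>))"
proof -
  have "\<forall>\<sigma>\<in>K. \<forall>\<tau>\<in>K. convex hull (vertex ` \<sigma>) \<inter> convex hull (vertex ` \<tau>)
    = convex hull (vertex ` (\<sigma> \<inter> \<tau>))"
    using assms(1) unfolding triangulates_boundary_def by (elim conjE)
  thus ?thesis using assms(2,3) by simp
qed

text \<open>The common point lies in the hull of the intersection of the two faces. By affine
  independence its coordinates in the first face are unique, so the strictly positive ones belong to
  vertices of the intersection.\<close>

lemma triangulation_support_subset:
  assumes tri: "triangulates_boundary n K" and K: "\<sigma> \<in> K" "\<tau> \<in> K"
    and u: "\<And>a. a \<in> \<sigma> \<Longrightarrow> u a > 0" "sum u \<sigma> = 1" and v: "\<And>a. a \<in> \<tau> \<Longrightarrow> v a > 0" "sum v \<tau> = 1"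
    and eq: "(\<Sum>a\<in>\<sigma>. u a *\<^sub>R vertex a) = (\<Sum>a\<in>\<tau>. v a *\<^sub>R vertex a)"
  shows "\<sigma> \<subseteq> \<tau>"
proof
  note K' = triangulation_face[OF tri]
  have "(\<Sum>a\<in>\<sigma>. u a *\<^sub>R vertex a) \<in> convex hull (vertex ` \<sigma>)"
    by (rule convex_sum) (use u K'[OF K(1)] in \<open>auto simp: hull_inc less_imp_le\<close>)
  moreover have "(\<Sum>a\<in>\<tau>. v a *\<^sub>R vertex a) \<in> convex hull (vertex ` \<tau>)"
    by (rule convex_sum) (use v K'[OF K(2)] in \<open>auto simp: hull_inc less_imp_le\<close>)
  ultimately have "(\<Sum>a\<in>\<sigma>. u a *\<^sub>R vertex a) \<in> convex hull (vertex ` (\<sigma> \<inter> \<tau>))"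
    using triangulation_hull_Int[OF tri K] eq by (metis IntI)
  moreover have "finite (\<sigma> \<inter> \<tau>)" "inj_on vertex (\<sigma> \<inter> \<tau>)"
    using K'[OF K(1)] by (auto simp: inj_on_def)
  ultimately obtain t where t: "sum t (\<sigma> \<inter> \<tau>) = 1"
      "(\<Sum>a\<in>\<sigma> \<inter> \<tau>. t a *\<^sub>R vertex a) = (\<Sum>a\<in>\<sigma>. u a *\<^sub>R vertex a)"
    using convex_hull_vertices by metis
  define t' where "t' a = (if a \<in> \<tau> then t a else 0)" for a
  have "sum t' \<sigma> = 1" "(\<Sum>a\<in>\<sigma>. t' a *\<^sub>R vertex a) = (\<Sum>a\<in>\<sigma>. u a *\<^sub>R vertex a)"
    using t K'[OF K(1)] by (simp_all add: t'_def if_distrib[of "\<lambda>r. r *\<^sub>R _"] sum.If_cases Int_def cong: if_cong)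
  hence *: "(\<Sum>a\<in>\<sigma>. u a - t' a) = 0" "(\<Sum>a\<in>\<sigma>. (u a - t' a) *\<^sub>R vertex a) = 0"
    using u by (simp_all add: sum_subtractf scaleR_diff_left)
  fix a assume a: "a \<in> \<sigma>"
  have "u a - t' a = 0"
    by (rule affine_independent_coeffs[OF K'[OF K(1)] * a])
  thus "a \<in> \<tau>" using u(1)[OF a] by (auto simp: t'_def split: if_splits)
qed

lemma triangulation_unique:
  assumes tri: "triangulates_boundary n K" and K: "\<sigma> \<in> K" "\<tau> \<in> K"
    and u: "\<And>a. a \<in> \<sigma> \<Longrightarrow> u a > 0" "sum u \<sigma> = 1" and v: "\<And>a. a \<in> \<tau> \<Longrightarrow> v a > 0" "sum v \<tau> = 1"
    and eq: "(\<Sum>a\<in>\<sigma>. u a *\<^sub>R vertex a) = (\<Sum>a\<in>\<tau>. v a *\<^sub>R vertex a)"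
  shows "\<sigma> = \<tau>" "\<And>a. a \<in> \<sigma> \<Longrightarrow> u a = v a"
proof -
  show *: "\<sigma> = \<tau>"
    using triangulation_support_subset[OF tri K u v eq]
      triangulation_support_subset[OF tri K(2,1) v u eq[symmetric]] by simp
  note K' = triangulation_face[OF tri K(1)]
  fix a assume "a \<in> \<sigma>"
  have "u a - v a = 0"
    using u v eq * by (intro affine_independent_coeffs[OF K', of "\<lambda>a. u a - v a"] \<open>a \<in> \<sigma>\<close>)
      (auto simp: sum_subtractf scaleR_diff_left)
  thus "u a = v a" by simp
qed

text \<open>Otherwise there are at least as many arrows as nodes, whereas the vertices of a face are linearly
  independent in a space of dimension one less than the number of nodes.\<close>

lemma face_leaf:
  assumes \<sigma>: "\<sigma> \<in> flag_complex R n" "\<sigma> \<noteq> {}"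
    and ind: "inj_on vertex \<sigma>" "\<not> affine_dependent (vertex ` \<sigma>)"
  shows "\<exists>a\<in>\<sigma>. \<exists>q\<in>endpoints a. \<forall>b\<in>\<sigma>. q \<in> endpoints b \<longrightarrow> b = a"
proof (rule ccontr)
  assume contra: "\<not> ?thesis"
  have "\<sigma> \<subseteq> arrows n" using \<sigma> by (simp add: flag_complex_def)
  hence fin: "finite \<sigma>" by (rule finite_subset) simp
  define N where "N = (\<Union>a\<in>\<sigma>. endpoints a)"
  have finN: "finite N" using fin by (auto simp: N_def endpoints_def)
  have "2 \<le> card {a \<in> \<sigma>. q \<in> endpoints a}" if "q \<in> N" for q
  proof -
    have "\<exists>a\<in>\<sigma>. q \<in> endpoints a" using that by (simp add: N_def)
    then obtain a where a: "a \<in> \<sigma>" "q \<in> endpoints a" ..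
    then obtain b where "b \<in> \<sigma>" "q \<in> endpoints b" "b \<noteq> a"
      using contra by blast
    hence "card {a, b} \<le> card {a \<in> \<sigma>. q \<in> endpoints a}"
      using a fin by (intro card_mono) auto
    thus ?thesis using \<open>b \<noteq> a\<close> by simp
  qed
  hence "2 * card N \<le> (\<Sum>q\<in>N. card {a \<in> \<sigma>. q \<in> endpoints a})"
    using sum_mono[of N "\<lambda>_. 2" "\<lambda>q. card {a \<in> \<sigma>. q \<in> endpoints a}"] by simp
  also have "\<dots> = (\<Sum>a\<in>\<sigma>. card {q \<in> N. q \<in> endpoints a})"
    by (rule sum_multicount_gen) (use finN fin in auto)
  also have "\<dots> = (\<Sum>a\<in>\<sigma>. 2)"
  proof (rule sum.cong)
    fix a assume "a \<in> \<sigma>"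
    hence "{q \<in> N. q \<in> endpoints a} = {tail a, head a}" "tail a \<noteq> head a"
      using \<open>\<sigma> \<subseteq> arrows n\<close> by (auto simp: N_def endpoints_def arrows_def tail_def head_def)
    thus "card {q \<in> N. q \<in> endpoints a} = 2" by simp
  qed simp
  finally have le: "card N \<le> card \<sigma>" by simp
  have "independent (vertex ` \<sigma>)"
    unfolding dependent_finite[OF finite_imageI[OF fin]]
  proof clarify
    fix U a assume *: "(\<Sum>x\<in>vertex ` \<sigma>. U x *\<^sub>R x) = 0" "a \<in> \<sigma>" "U (vertex a) \<noteq> 0"
    have 0: "(\<Sum>a\<in>\<sigma>. U (vertex a) *\<^sub>R vertex a) = 0"
      using *(1) ind(1) by (simp add: sum.reindex)
    \<comment> \<open>Summing the coordinates over the heads gives 1 at every vertex of the face, as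
      no tail is a head. A linear relation therefore has coefficient sum 0 and is an affine
      relation.\<close>
    define J where "J = head ` \<sigma>"
    have "0 = (\<Sum>q\<in>J. Poly_Mapping.lookup (\<Sum>a\<in>\<sigma>. U (vertex a) *\<^sub>R vertex a) q)"
      by (simp add: 0)
    also have "\<dots> = (\<Sum>a\<in>\<sigma>. U (vertex a) * (\<Sum>q\<in>J. Poly_Mapping.lookup (vertex a) q))"
      by (simp add: lookup_sum lookup_scaleR sum_distrib_left, rule sum.swap)
    also have "\<dots> = (\<Sum>a\<in>\<sigma>. U (vertex a))"
    proof (rule sum.cong)
      fix a assume "a \<in> \<sigma>"
      hence "head a \<in> J" "tail a \<notin> J"
        unfolding J_def image_iff using face_no_path[OF \<sigma>(1) _ \<open>a \<in> \<sigma>\<close>] by metis+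
      thus "U (vertex a) * (\<Sum>q\<in>J. Poly_Mapping.lookup (vertex a) q) = U (vertex a)"
        using fin by (simp add: lookup_vertex sum_subtractf J_def)
    qed simp
    finally have "U (vertex a) = 0"
      using affine_independent_coeffs[OF fin ind, of "U \<circ> vertex" a] 0 * by simp
    thus False using * by simp
  qed
  have "N \<noteq> {}" using \<sigma>(2) unfolding N_def endpoints_def by blast
  then obtain q0 where q0: "q0 \<in> N" by blast
  define B where "B = (\<lambda>q. unit_vec q - unit_vec q0) ` (N - {q0})"
  have "unit_vec q - unit_vec q0 \<in> span B" if "q \<in> N" for q
    using that by (cases "q = q0") (auto simp: B_def span_zero intro: span_base)
  note in_span = this
  have "vertex a \<in> span B" if "a \<in> \<sigma>" for a
  proof -
    have "(unit_vec (head a) - unit_vec q0) - (unit_vec (tail a) - unit_vec q0) \<in> span B"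
      by (rule span_diff; rule in_span) (use that in \<open>auto simp: N_def endpoints_def\<close>)
    thus ?thesis by (simp add: vertex_def)
  qed
  hence "vertex ` \<sigma> \<subseteq> span B" by blast
  with \<open>independent _\<close> have "card (vertex ` \<sigma>) \<le> card B"
    using independent_span_bound[of B "vertex ` \<sigma>"] finN by (auto simp: B_def)
  also have "card B \<le> card (N - {q0})" unfolding B_def using finN by (intro card_image_le) auto
  also have "\<dots> < card N" using q0 finN by (intro psubset_card_mono) auto
  finally show False using le ind(1) by (simp add: card_image)
qed

text \<open>Unimodularity by stripping leaves: at a leaf the coordinate of the sum is plus or minus
  the coefficient of its only arrow. That coefficient is thus an integer, and subtracting its term
  leaves integral coordinates on a smaller face.\<close>

lemma face_coeffs_integral:
  assumes tri: "triangulates_boundary n (flag_complex R n)"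
    and "\<sigma> \<in> flag_complex R n"
    and "\<And>q. Poly_Mapping.lookup (\<Sum>a\<in>\<sigma>. c a *\<^sub>R vertex a) q \<in> \<int>"
    and "a \<in> \<sigma>"
  shows "c a \<in> \<int>"
proof -
  have "finite \<sigma>"
    using tri assms(2) by (rule triangulation_face)
  thus ?thesis
    using assms(2-4)
  proof (induction \<sigma> arbitrary: a rule: finite_psubset_induct)
    case (psubset \<sigma>)
    obtain q b where b: "b \<in> \<sigma>" "q \<in> endpoints b" "\<And>b'. b' \<in> \<sigma> \<Longrightarrow> q \<in> endpoints b' \<Longrightarrow> b' = b"
      using face_leaf[OF psubset.prems(1) _ triangulation_face(2,3)[OF tri psubset.prems(1)]] psubset.prems(3)
      by blast
    have split: "(\<Sum>a\<in>\<sigma>. c a *\<^sub>R vertex a) = c b *\<^sub>R vertex b + (\<Sum>a\<in>\<sigma> - {b}. c a *\<^sub>R vertex a)"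
      using psubset.hyps b(1) by (simp add: sum.remove)
    have "tail b \<noteq> head b"
      using b(1) psubset.prems(1) by (auto simp: flag_complex_def arrows_def tail_def head_def)
    hence "Poly_Mapping.lookup (vertex b) q \<in> {1, - 1}"
      using b(2) by (auto simp: lookup_vertex endpoints_def)
    moreover have "Poly_Mapping.lookup (\<Sum>a\<in>\<sigma> - {b}. c a *\<^sub>R vertex a) q = 0"
      unfolding lookup_sum
    proof (rule sum.neutral, rule ballI)
      fix a assume "a \<in> \<sigma> - {b}"
      hence "q \<notin> endpoints a" using b(3) by blast
      thus "Poly_Mapping.lookup (c a *\<^sub>R vertex a) q = 0"
        by (simp add: lookup_scaleR lookup_vertex endpoints_def)
    qed
    ultimately have cb: "c b \<in> \<int>"
      using psubset.prems(2)[of q] unfolding split by (auto simp: lookup_add lookup_scaleR)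
    show ?case
    proof (cases "a = b")
      case False
      have "Poly_Mapping.lookup (\<Sum>a\<in>\<sigma> - {b}. c a *\<^sub>R vertex a) q \<in> \<int>" for q
      proof -
        have "Poly_Mapping.lookup (\<Sum>a\<in>\<sigma> - {b}. c a *\<^sub>R vertex a) q
          = Poly_Mapping.lookup (\<Sum>a\<in>\<sigma>. c a *\<^sub>R vertex a) q - c b * Poly_Mapping.lookup (vertex b) q"
          unfolding split by (simp add: lookup_add lookup_scaleR)
        also have "\<dots> \<in> \<int>"
          using psubset.prems(2) cb by (intro Ints_diff Ints_mult) (auto simp: lookup_vertex)
        finally show ?thesis .
      qed
      moreover have "\<sigma> - {b} \<in> flag_complex R n"
        using psubset.prems(1) by (auto simp: flag_complex_def)
      ultimately show ?thesis
        using psubset.IH[of "\<sigma> - {b}" a] b(1) False psubset.prems(3) by blast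
    qed (use cb in simp)
  qed
qed

section \<open>The bijection between weighted saturated faces and lists\<close>

definition saturated_weights :: "(end_kind list \<Rightarrow> matching) \<Rightarrow> nat \<Rightarrow> (arrow \<Rightarrow> nat) set" where
  "saturated_weights R n = {w. supp w \<in> flag_complex R n \<and> saturated n (supp w)}"

definition nonzero_lists :: "nat \<Rightarrow> int list set" where
  "nonzero_lists l = {xs. length xs = l \<and> 0 \<notin> set xs \<and> sum_list xs = 0}"

lemma lookup_weighted_vertices:
  "Poly_Mapping.lookup (\<Sum>a\<in>arrows n. real (w a) *\<^sub>R vertex a) q = - real_of_int (excess n w q)"
  unfolding excess_def lookup_sum lookup_scaleR lookup_vertex of_int_sum sum_negf[symmetric]
  by (intro sum.cong) auto

lemma excess_outside: "q \<notin> {1..n + 1} \<Longrightarrow> excess n w q = 0"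
  unfolding excess_def by (intro sum.neutral) (auto simp: arrows_def tail_def head_def)

lemma excess_nonzero:
  assumes w: "supp w \<in> flag_complex R n" and a: "a \<in> supp w" "q \<in> endpoints a"
  shows "excess n w q \<noteq> 0"
proof -
  have arr: "a \<in> arrows n" using w a(1) by (auto simp: flag_complex_def)
  have pos: "int (w a) > 0" using a(1) by (simp add: supp_def)
  consider "q = tail a" | "q = head a" using a(2) by (auto simp: endpoints_def)
  thus ?thesis
  proof cases
    case 1
    have "w b = 0" if "head b = q" for b
      using face_no_path[OF w _ a(1), of b] that 1 by (auto simp: supp_def)
    hence eq: "excess n w q = (\<Sum>b\<in>arrows n. if tail b = q then int (w b) else 0)"
      unfolding excess_def by (intro sum.cong) auto
    have "(\<Sum>b\<in>arrows n. if tail b = q then int (w b) else 0) > 0"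
      by (rule sum_pos2[of _ a]) (use arr pos 1 in auto)
    thus ?thesis unfolding eq by simp
  next
    case 2
    have "w b = 0" if "tail b = q" for b
      using face_no_path[OF w a(1), of b] that 2 by (auto simp: supp_def)
    hence eq: "excess n w q = - (\<Sum>b\<in>arrows n. if head b = q then int (w b) else 0)"
      unfolding excess_def sum_negf[symmetric] by (intro sum.cong) auto
    have "(\<Sum>b\<in>arrows n. if head b = q then int (w b) else 0) > 0"
      by (rule sum_pos2[of _ a]) (use arr pos 2 in auto)
    thus ?thesis unfolding eq by simp
  qed
qed

lemma excess_list_in:
  assumes "n \<ge> 1" "w \<in> saturated_weights R n"
  shows "excess_list n w \<in> nonzero_lists (n + 1)"
proof -
  have w: "supp w \<in> flag_complex R n" "(\<Union>a\<in>supp w. endpoints a) = {1..n + 1}"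
    using assms by (auto simp: saturated_weights_def saturated_def)
  have "excess n w q \<noteq> 0" if "q \<in> {1..n + 1}" for q
  proof -
    have "q \<in> (\<Union>a\<in>supp w. endpoints a)" using that w(2) by simp
    then obtain a where "a \<in> supp w" "q \<in> endpoints a" by (rule UN_E)
    thus ?thesis by (rule excess_nonzero[OF w(1)])
  qed
  thus ?thesis
    unfolding nonzero_lists_def mem_Collect_eq
    by (intro conjI sum_excess_list) (auto simp: excess_list_def simp del: upt_Suc)
qed

lemma total_weight_pos:
  assumes "n \<ge> 1" "w \<in> saturated_weights R n"
  shows "(\<Sum>a\<in>arrows n. w a) > 0"
proof -
  have "supp w \<noteq> {}" "supp w \<subseteq> arrows n"
    using assms by (auto simp: saturated_weights_def saturated_def)
  then obtain a where "a \<in> arrows n" "w a > 0" by (auto simp: supp_def)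
  thus ?thesis by (intro sum_pos2[of _ a]) auto
qed

lemma sum_over_supp:
  assumes "supp w \<subseteq> arrows n" "\<And>a. w a = 0 \<Longrightarrow> g a = 0"
  shows "(\<Sum>a\<in>supp w. g a) = (\<Sum>a\<in>arrows n. g a)"
  by (rule sum.mono_neutral_left) (use assms in \<open>auto simp: supp_def\<close>)

text \<open>Equal lists have equal ascent, so both weightings have the same total c. Divided by c
  they are strictly positive barycentric coordinates of the same point, which determines face and
  coordinates.\<close>

lemma inj_on_excess_list:
  assumes "n \<ge> 1" and tri: "triangulates_boundary n (flag_complex R n)"
  shows "inj_on (excess_list n) (saturated_weights R n)"
proof (rule inj_onI)
  fix w w' assume w: "w \<in> saturated_weights R n" "w' \<in> saturated_weights R n"
    and eq: "excess_list n w = excess_list n w'"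
  define c where "c = real (\<Sum>a\<in>arrows n. w a)"
  have face: "supp w \<in> flag_complex R n" "supp w' \<in> flag_complex R n"
    using w by (simp_all add: saturated_weights_def)
  hence sub: "supp w \<subseteq> arrows n" "supp w' \<subseteq> arrows n"
    by (simp_all add: flag_complex_def)
  have c: "c = real (\<Sum>a\<in>arrows n. w' a)"
    using eq ups_excess_list[OF face(1)] ups_excess_list[OF face(2)] unfolding c_def by metis
  have "c > 0" using total_weight_pos[OF assms(1) w(1)] unfolding c_def by (simp only: of_nat_0_less_iff)
  have "excess n w q = excess n w' q" if "q \<in> {1..<n + 2}" for q
    using eq that unfolding excess_list_def map_eq_conv set_upt by blast
  hence "excess n w q = excess n w' q" for q
    using excess_outside[of q n] by (cases "q \<in> {1..n + 1}") auto
  hence "(\<Sum>a\<in>arrows n. real (w a) *\<^sub>R vertex a) = (\<Sum>a\<in>arrows n. real (w' a) *\<^sub>R vertex a)"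
    by (intro poly_mapping_eqI) (simp only: lookup_weighted_vertices)
  hence "(\<Sum>a\<in>arrows n. (real (w a) / c) *\<^sub>R vertex a) = (\<Sum>a\<in>arrows n. (real (w' a) / c) *\<^sub>R vertex a)"
    by (simp add: divide_inverse mult.commute[of _ "inverse c"] flip: scaleR_scaleR scaleR_sum_right)
  hence pt: "(\<Sum>a\<in>supp w. (real (w a) / c) *\<^sub>R vertex a) = (\<Sum>a\<in>supp w'. (real (w' a) / c) *\<^sub>R vertex a)"
    using sub by (simp add: sum_over_supp)
  have one: "(\<Sum>a\<in>supp w. real (w a) / c) = 1" "(\<Sum>a\<in>supp w'. real (w' a) / c) = 1"
  proof -
    have "(\<Sum>a\<in>arrows n. real (w a) / c) = c / c"
      unfolding sum_divide_distrib[symmetric] of_nat_sum[symmetric] c_def ..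
    moreover have "(\<Sum>a\<in>arrows n. real (w' a) / c) = c / c"
      unfolding sum_divide_distrib[symmetric] of_nat_sum[symmetric] c[symmetric] ..
    ultimately show "(\<Sum>a\<in>supp w. real (w a) / c) = 1" "(\<Sum>a\<in>supp w'. real (w' a) / c) = 1"
      using sub \<open>c > 0\<close> by (simp_all add: sum_over_supp)
  qed
  have pos: "real (w a) / c > 0" if "a \<in> supp w" for a
    using that \<open>c > 0\<close> by (simp add: supp_def)
  have pos': "real (w' a) / c > 0" if "a \<in> supp w'" for a
    using that \<open>c > 0\<close> by (simp add: supp_def)
  have eq_supp: "supp w = supp w'"
    by (rule triangulation_unique(1)[OF tri face pos one(1) pos' one(2) pt])
  have eq_on: "real (w a) / c = real (w' a) / c" if "a \<in> supp w" for a
    using that by (rule triangulation_unique(2)[OF tri face pos one(1) pos' one(2) pt, rotated 2])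
  show "w = w'"
  proof
    fix a
    show "w a = w' a"
    proof (cases "a \<in> supp w")
      case True
      thus ?thesis using eq_on[OF True] \<open>c > 0\<close> by simp
    next
      case False
      hence "a \<notin> supp w'" using eq_supp by simp
      thus ?thesis using False by (simp add: supp_def)
    qed
  qed
qed

lemma face_subset: "\<sigma> \<in> flag_complex R n \<Longrightarrow> \<tau> \<subseteq> \<sigma> \<Longrightarrow> \<tau> \<in> flag_complex R n"
  unfolding flag_complex_def mem_Collect_eq by (meson subset_trans subsetD)

text \<open>Scaling by the ascent c puts the list on the boundary, hence into some face; c times the
  barycentric coordinates are the weights.\<close>

lemma excess_list_surj:
  assumes "n \<ge> 1" and tri: "triangulates_boundary n (flag_complex R n)"
    and xs: "xs \<in> nonzero_lists (n + 1)"
  shows "xs \<in> excess_list n ` saturated_weights R n"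
proof -
  let ?K = "flag_complex R n"
  define N where "N = {1..n + 1}"
  have [simp]: "finite N" by (simp add: N_def)
  have xs': "length xs = n + 1" "0 \<notin> set xs" "sum_list xs = 0"
    using xs by (auto simp: nonzero_lists_def)
  have sum_xs: "(\<Sum>x\<leftarrow>xs. g x) = (\<Sum>q\<in>N. g (xs ! (q - 1)))" for g :: "int \<Rightarrow> real"
  proof -
    have "(\<Sum>x\<leftarrow>xs. g x) = (\<Sum>i<n + 1. g (xs ! i))"
      using xs'(1) by (simp add: sum_list_sum_nth atLeast0LessThan)
    also have "\<dots> = (\<Sum>q\<in>N. g (xs ! (q - 1)))"
      by (rule sum.reindex_bij_witness[of _ "\<lambda>q. q - 1" Suc]) (auto simp: N_def)
    finally show ?thesis .
  qed
  define c where "c = real (ups xs)"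
  obtain x where x: "x \<in> set xs" using xs'(1) by (cases xs) auto
  hence "\<bar>x\<bar> \<le> 2 * int (ups xs)" "x \<noteq> 0" using abs_le_ups[OF x] xs' by auto
  hence "c > 0" by (simp add: c_def)
  \<comment> \<open>The sign is due to \<open>vertex\<close> being head minus tail, while
    \<open>excess\<close> is out minus in.\<close>
  define v where "v q = - real_of_int (xs ! (q - 1)) / c" for q
  have "(\<Sum>q\<in>N. v q) = - (\<Sum>x\<leftarrow>xs. real_of_int x) / c"
    unfolding sum_xs v_def by (simp add: sum_negf sum_divide_distrib)
  also have "(\<Sum>x\<leftarrow>xs. real_of_int x) = real_of_int (sum_list xs)"
    by (induction xs) auto
  finally have bal: "(\<Sum>q\<in>N. v q) = 0" using xs'(3) by simp
  have "(\<Sum>q\<in>N. max 0 (v q)) = (\<Sum>x\<leftarrow>xs. max 0 (- real_of_int x / c))"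
    unfolding sum_xs v_def by simp
  also have "\<dots> = (\<Sum>x\<leftarrow>xs. max 0 (- real_of_int x)) / c"
    using \<open>c > 0\<close> by (induction xs) (auto simp: max_def field_simps)
  also have "(\<Sum>x\<leftarrow>xs. max 0 (- real_of_int x)) = real_of_int (int (ups xs) - sum_list xs)"
    by (induction xs) auto
  finally have one: "(\<Sum>q\<in>N. max 0 (v q)) = 1"
    using xs'(3) \<open>c > 0\<close> by (simp add: c_def)
  have "(\<Sum>q\<in>N. v q *\<^sub>R unit_vec q) \<in> rel_frontier (root_polytope n)"
    unfolding N_def by (rule balanced_point_in_rel_frontier) (use assms(1) bal one in \<open>simp_all only: N_def\<close>)
  also have "rel_frontier (root_polytope n) = (\<Union>\<sigma>\<in>?K. convex hull (vertex ` \<sigma>))"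
    using tri unfolding triangulates_boundary_def by (elim conjE) (rule sym)
  finally obtain \<sigma> where \<sigma>: "\<sigma> \<in> ?K" "(\<Sum>q\<in>N. v q *\<^sub>R unit_vec q) \<in> convex hull (vertex ` \<sigma>)"
    by (rule UN_E)
  note fin = triangulation_face[OF tri \<sigma>(1)]
  obtain u where u: "\<And>a. a \<in> \<sigma> \<Longrightarrow> u a \<ge> 0"
    "(\<Sum>a\<in>\<sigma>. u a *\<^sub>R vertex a) = (\<Sum>q\<in>N. v q *\<^sub>R unit_vec q)"
    using convex_hull_vertices[OF fin(1,2) \<sigma>(2)] by metis
  have pt: "(\<Sum>a\<in>\<sigma>. (c * u a) *\<^sub>R vertex a) = (\<Sum>q\<in>N. - real_of_int (xs ! (q - 1)) *\<^sub>R unit_vec q)"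
  proof -
    have "(\<Sum>a\<in>\<sigma>. (c * u a) *\<^sub>R vertex a) = c *\<^sub>R (\<Sum>q\<in>N. v q *\<^sub>R unit_vec q)"
      unfolding u(2)[symmetric] scaleR_sum_right by simp
    also have "\<dots> = (\<Sum>q\<in>N. - real_of_int (xs ! (q - 1)) *\<^sub>R unit_vec q)"
      unfolding scaleR_sum_right using \<open>c > 0\<close> by (simp add: v_def)
    finally show ?thesis .
  qed
  have coord: "Poly_Mapping.lookup (\<Sum>a\<in>\<sigma>. (c * u a) *\<^sub>R vertex a) q
      = (if q \<in> N then - real_of_int (xs ! (q - 1)) else 0)" for q
    unfolding pt by (simp add: lookup_sum lookup_scaleR lookup_unit_vec if_distrib cong: if_cong)
  have int: "c * u a \<in> \<int>" if "a \<in> \<sigma>" for a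
    by (rule face_coeffs_integral[OF tri \<sigma>(1) _ that]) (simp add: coord)
  define w where "w a = (if a \<in> \<sigma> then nat \<lfloor>c * u a\<rfloor> else 0)" for a
  have w: "real (w a) = c * u a" if "a \<in> \<sigma>" for a
    using int[OF that] u(1)[OF that] \<open>c > 0\<close> that by (auto simp: w_def elim!: Ints_cases)
  \<comment> \<open>The inclusion may be strict, since the point may lie on the boundary of the
    simplex; the face wanted is the support.\<close>
  have sub: "supp w \<subseteq> \<sigma>" by (auto simp: supp_def w_def)
  have "\<sigma> \<subseteq> arrows n" using \<sigma>(1) by (simp add: flag_complex_def)
  have face: "supp w \<in> ?K" by (rule face_subset[OF \<sigma>(1) sub])
  have "(\<Sum>a\<in>arrows n. real (w a) *\<^sub>R vertex a) = (\<Sum>a\<in>\<sigma>. (c * u a) *\<^sub>R vertex a)"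
    by (rule sum.mono_neutral_cong_right) (use \<open>\<sigma> \<subseteq> arrows n\<close> w in \<open>auto simp: w_def\<close>)
  hence ex: "excess n w q = xs ! (q - 1)" if "q \<in> N" for q
    using coord[of q] lookup_weighted_vertices[of w n q] that by simp
  have "excess_list n w = xs"
    by (rule nth_equalityI) (use xs'(1) ex in \<open>auto simp: excess_list_def N_def simp del: upt_Suc\<close>)
  \<comment> \<open>A node without arrows would have excess 0, whereas all entries of the list are
    nonzero.\<close>
  moreover have "q \<in> (\<Union>a\<in>supp w. endpoints a)" if "q \<in> N" for q
  proof (rule ccontr)
    assume *: "q \<notin> (\<Union>a\<in>supp w. endpoints a)"
    have "excess n w q = 0"
      unfolding excess_def
    proof (rule sum.neutral, rule ballI)
      fix a
      show "(if tail a = q then int (w a) else 0) - (if head a = q then int (w a) else 0) = 0"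
      proof (cases "a \<in> supp w")
        case True
        hence "q \<notin> endpoints a" using * by blast
        thus ?thesis by (simp add: endpoints_def)
      qed (simp add: supp_def)
    qed
    moreover have "xs ! (q - 1) \<noteq> 0"
    proof -
      have "q - 1 < length xs" using that xs'(1) by (auto simp: N_def)
      hence "xs ! (q - 1) \<in> set xs" by (rule nth_mem)
      thus ?thesis using xs'(2) by metis
    qed
    ultimately show False using ex[OF that] by simp
  qed
  moreover have "endpoints a \<subseteq> N" if "a \<in> supp w" for a
    using that sub \<open>\<sigma> \<subseteq> arrows n\<close> by (auto simp: endpoints_def N_def arrows_def tail_def head_def)
  ultimately have "w \<in> saturated_weights R n" "excess_list n w = xs"
    using assms(1) face sub \<open>\<sigma> \<subseteq> arrows n\<close>
    unfolding saturated_weights_def saturated_def N_def by auto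
  thus ?thesis by blast
qed

lemma bij_betw_excess_list:
  assumes "n \<ge> 1" "triangulates_boundary n (flag_complex R n)"
  shows "bij_betw (excess_list n) (saturated_weights R n) (nonzero_lists (n + 1))"
proof (rule bij_betw_imageI[OF inj_on_excess_list[OF assms]])
  show "excess_list n ` saturated_weights R n = nonzero_lists (n + 1)"
    by (intro equalityI subsetI excess_list_surj[OF assms])
       (auto simp: excess_list_in[OF assms(1)] simp del: One_nat_def)
qed

text \<open>\<open>f\<close> and \<open>b\<close> are left abstract so that forward and backward
  weights can exchange roles.\<close>

lemma card_weights_bridges:
  assumes bij: "bij_betw g S (nonzero_lists l)"
    and g: "\<And>w. w \<in> S \<Longrightarrow> peak (g w) = int (f w)" "\<And>w. w \<in> S \<Longrightarrow> ups (g w) = f w + b w"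
  shows "card {w \<in> S. f w = m \<and> b w = k} = card (bridges l m k)"
proof -
  have "inj_on g {w \<in> S. f w = m \<and> b w = k}"
    using bij by (auto simp: bij_betw_def inj_on_def)
  moreover have "g ` {w \<in> S. f w = m \<and> b w = k} = bridges l m k"
  proof (intro equalityI subsetI)
    fix xs assume "xs \<in> g ` {w \<in> S. f w = m \<and> b w = k}"
    then obtain w where w: "w \<in> S" "f w = m" "b w = k" "xs = g w" by blast
    hence "xs \<in> nonzero_lists l" using bij by (auto simp: bij_betw_def)
    thus "xs \<in> bridges l m k" using w g[OF w(1)] by (simp add: bridges_def nonzero_lists_def)
  next
    fix xs assume xs: "xs \<in> bridges l m k"
    hence "xs \<in> nonzero_lists l" by (simp add: bridges_def nonzero_lists_def)
    then obtain w where w: "w \<in> S" "xs = g w" using bij by (auto simp: bij_betw_def)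
    thus "xs \<in> g ` {w \<in> S. f w = m \<and> b w = k}"
      using xs g[OF w(1)] by (auto simp: bridges_def)
  qed
  ultimately show ?thesis using card_image by fastforce
qed

definition fw_weight :: "nat \<Rightarrow> (arrow \<Rightarrow> nat) \<Rightarrow> nat" where
  "fw_weight n w = (\<Sum>a | a \<in> arrows n \<and> forward a. w a)"

definition bw_weight :: "nat \<Rightarrow> (arrow \<Rightarrow> nat) \<Rightarrow> nat" where
  "bw_weight n w = (\<Sum>a | a \<in> arrows n \<and> backward a. w a)"

lemma fw_bw_weight: "fw_weight n w + bw_weight n w = (\<Sum>a\<in>arrows n. w a)"
proof -
  have "(\<Sum>a\<in>arrows n. w a) = sum w ({a. a \<in> arrows n \<and> forward a} \<union> {a. a \<in> arrows n \<and> backward a})"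
    by (rule sum.cong) (auto simp: arrows_def forward_def backward_def tail_def head_def)
  also have "\<dots> = fw_weight n w + bw_weight n w"
    unfolding fw_weight_def bw_weight_def
    by (rule sum.union_disjoint) (auto simp: forward_def backward_def)
  finally show ?thesis ..
qed

lemma card_weights_forward:
  assumes "n \<ge> 1" "triangulates_boundary n (flag_complex R n)"
    and R: "rule_set R" "simion_class R" "R THTH = Nesting"
  shows "card {w \<in> saturated_weights R n. fw_weight n w = m \<and> bw_weight n w = k}
    = card (bridges (n + 1) m k)"
  using bij_betw_excess_list[OF assms(1,2)]
proof (rule card_weights_bridges)
  fix w assume "w \<in> saturated_weights R n"
  hence w: "supp w \<in> flag_complex R n" by (simp add: saturated_weights_def)
  show "peak (excess_list n w) = int (fw_weight n w)"
    using peak_excess_list[OF R w] by (simp add: fw_weight_def)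
  show "ups (excess_list n w) = fw_weight n w + bw_weight n w"
    using ups_excess_list[OF w] by (simp add: fw_bw_weight)
qed

fun flip_kind :: "end_kind \<Rightarrow> end_kind" where
  "flip_kind T = H" | "flip_kind H = T"

text \<open>Reversal keeps the endpoint sets, hence the matching, and only exchanges the letters of
  the type.\<close>

lemma edge_swap:
  assumes "tail a \<noteq> head a" "tail b \<noteq> head b"
  shows "edge R a b \<longleftrightarrow> edge (\<lambda>t. R (map flip_kind t)) (prod.swap a) (prod.swap b)"
proof -
  have sw: "tail (prod.swap c) = head c" "head (prod.swap c) = tail c" for c :: arrow
    by (simp_all add: tail_def head_def)
  have ends: "endpoints (prod.swap c) = endpoints c" for c
    by (auto simp: endpoints_def sw)
  have match: "pair_matching (prod.swap a) (prod.swap b) = pair_matching a b"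
    by (simp only: pair_matching_def ends)
  have "map flip_kind (pair_type (prod.swap a) (prod.swap b)) = pair_type a b"
    if "card (endpoints a \<union> endpoints b) = 4"
  proof -
    have "{tail a, tail b} \<inter> {head a, head b} = {}"
    proof (rule ccontr)
      assume "{tail a, tail b} \<inter> {head a, head b} \<noteq> {}"
      hence "tail a = head b \<or> tail b = head a" using assms by auto
      hence "card (endpoints a \<union> endpoints b) \<le> 3"
        by (auto simp: endpoints_def insert_commute card_insert_if)
      thus False using that by simp
    qed
    moreover have "x \<in> {tail a, tail b, head a, head b}"
      if "x \<in> set (sorted_list_of_set (endpoints a \<union> endpoints b))" for x
      using that by (subst (asm) set_sorted_list_of_set) (auto simp: endpoints_def)
    ultimately show ?thesis
      unfolding pair_type_def ends map_map by (intro map_cong refl) (auto simp: sw)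
  qed
  thus ?thesis
    unfolding edge_def match ends sw by (auto simp: prod.swap_def prod_eq_iff)
qed

section \<open>Reversing the arrows\<close>

lemma arrow_swap:
  "tail (prod.swap a) = head a" "head (prod.swap a) = tail a"
  "forward (prod.swap a) = backward a" "backward (prod.swap a) = forward a"
  "prod.swap a \<in> arrows n \<longleftrightarrow> a \<in> arrows n"
  by (cases a; auto simp: tail_def head_def forward_def backward_def arrows_def)+

lemma face_swap:
  assumes "\<sigma> \<in> flag_complex R n"
  shows "prod.swap ` \<sigma> \<in> flag_complex (\<lambda>t. R (map flip_kind t)) n"
proof -
  have sub: "\<sigma> \<subseteq> arrows n" using assms by (simp add: flag_complex_def)
  have "edge (\<lambda>t. R (map flip_kind t)) (prod.swap a) (prod.swap b)"
    if "a \<in> \<sigma>" "b \<in> \<sigma>" "a \<noteq> b" for a b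
  proof -
    have "tail a \<noteq> head a" "tail b \<noteq> head b"
      using that sub by (auto simp: arrows_def tail_def head_def)
    thus ?thesis using face_edge[OF assms that] edge_swap by blast
  qed
  moreover have "prod.swap ` \<sigma> \<subseteq> arrows n"
    using sub arrow_swap(5) by blast
  ultimately show ?thesis
    unfolding flag_complex_def by (auto simp del: split_paired_All)
qed

lemma excess_swap: "excess n (w \<circ> prod.swap) q = - excess n w q"
proof -
  have "excess n (w \<circ> prod.swap) q = (\<Sum>a\<in>arrows n.
      (if head a = q then int (w a) else 0) - (if tail a = q then int (w a) else 0))"
    unfolding excess_def
    by (rule sum.reindex_bij_witness[of _ prod.swap prod.swap]) (auto simp: arrow_swap)
  also have "\<dots> = - excess n w q"
    unfolding excess_def sum_negf[symmetric] by (intro sum.cong) auto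
  finally show ?thesis .
qed

lemma bij_betw_uminus_nonzero_lists:
  "bij_betw (map uminus) (nonzero_lists l) (nonzero_lists l)"
proof (rule bij_betw_byWitness[of _ "map uminus"])
  have "sum_list (map uminus xs) = - sum_list xs" for xs :: "int list"
    by (induction xs) auto
  thus "map uminus ` nonzero_lists l \<subseteq> nonzero_lists l" "map uminus ` nonzero_lists l \<subseteq> nonzero_lists l"
    by (auto simp: nonzero_lists_def)
qed (simp_all add: o_def)

text \<open>The bijection is the one for \<open>R\<close> followed by negating the entries. The
  maximum of the negated list is read off from the reversed face, which obeys the flipped rules,
  where THTH nests.\<close>

lemma card_weights_backward:
  assumes "n \<ge> 1" "triangulates_boundary n (flag_complex R n)"
    and R: "rule_set R" "simion_class R" "R HTHT = Nesting"
  shows "card {w \<in> saturated_weights R n. bw_weight n w = m \<and> fw_weight n w = k}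
    = card (bridges (n + 1) m k)"
proof -
  let ?R = "\<lambda>t. R (map flip_kind t)"
  \<comment> \<open>Flipping exchanges THTH with HTHT, THHT with HTTH and TTHH with HHTT, and the
    conditions on the last two pairs are symmetric.\<close>
  have R': "rule_set ?R" "simion_class ?R" "?R THTH = Nesting"
    using R by (auto simp: rule_set_def simion_class_def)
  have "map uminus (excess_list n w) = excess_list n (w \<circ> prod.swap)" for w
    by (simp add: excess_list_def excess_swap del: upt_Suc)
  hence bij: "bij_betw (\<lambda>w. excess_list n (w \<circ> prod.swap)) (saturated_weights R n) (nonzero_lists (n + 1))"
    using bij_betw_trans[OF bij_betw_excess_list[OF assms(1,2)] bij_betw_uminus_nonzero_lists]
    by (simp add: o_def)
  show ?thesis
    using bij
  proof (rule card_weights_bridges)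
    fix w assume "w \<in> saturated_weights R n"
    moreover have "supp (w \<circ> prod.swap) = prod.swap ` supp w"
      by (force simp: supp_def)
    ultimately have w: "supp (w \<circ> prod.swap) \<in> flag_complex ?R n"
      using face_swap by (simp add: saturated_weights_def)
    have "(\<Sum>a | a \<in> arrows n \<and> forward a. (w \<circ> prod.swap) a) = bw_weight n w"
      unfolding bw_weight_def
      by (rule sum.reindex_bij_witness[of _ prod.swap prod.swap]) (auto simp: arrow_swap)
    thus "peak (excess_list n (w \<circ> prod.swap)) = int (bw_weight n w)"
      using peak_excess_list[OF R' w] by simp
    have "(\<Sum>a\<in>arrows n. (w \<circ> prod.swap) a) = (\<Sum>a\<in>arrows n. w a)"
      by (rule sum.reindex_bij_witness[of _ prod.swap prod.swap]) (auto simp: arrow_swap)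
    thus "ups (excess_list n (w \<circ> prod.swap)) = bw_weight n w + fw_weight n w"
      using ups_excess_list[OF w] fw_bw_weight[of n w] by simp
  qed
qed

section \<open>From weighted faces to faces\<close>

definition weights_on :: "arrow set \<Rightarrow> nat \<Rightarrow> (arrow \<Rightarrow> nat) set" where
  "weights_on A m = {w. supp w = A \<and> sum w A = m}"

lemma weights_on_insert:
  assumes "finite A" "a \<notin> A"
  shows "weights_on (insert a A) m = (\<Union>i\<in>{1..m}. (\<lambda>w. w(a := i)) ` weights_on A (m - i))"
proof (intro equalityI subsetI)
  fix w assume w: "w \<in> weights_on (insert a A) m"
  hence sup: "w b > 0 \<longleftrightarrow> b \<in> insert a A" for b
    by (auto simp: weights_on_def supp_def)
  have tot: "w a + sum w A = m" using w assms by (simp add: weights_on_def)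
  have "sum (w(a := 0)) A = sum w A" using assms by (intro sum.cong) auto
  moreover have "supp (w(a := 0)) = A" using sup assms(2) by (auto simp: supp_def)
  ultimately have "w(a := 0) \<in> weights_on A (m - w a)"
    using tot by (simp add: weights_on_def)
  hence "(w(a := 0))(a := w a) \<in> (\<lambda>w'. w'(a := w a)) ` weights_on A (m - w a)"
    by (rule imageI)
  moreover have "w a \<in> {1..m}" using tot sup[of a] by simp
  ultimately show "w \<in> (\<Union>i\<in>{1..m}. (\<lambda>w. w(a := i)) ` weights_on A (m - i))"
    by auto
next
  fix w assume "w \<in> (\<Union>i\<in>{1..m}. (\<lambda>w. w(a := i)) ` weights_on A (m - i))"
  then obtain i w' where i: "i \<in> {1..m}" "supp w' = A" "sum w' A = m - i" "w = w'(a := i)"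
    by (auto simp: weights_on_def)
  have "sum w A = sum w' A" using assms i by (intro sum.cong) auto
  thus "w \<in> weights_on (insert a A) m"
    using i assms by (auto simp: weights_on_def supp_def)
qed

text \<open>Splitting by the weight i >= 1 of the added arrow is a convolution with
  \<open>geom\<close>.\<close>

lemma card_weights_on:
  "finite A \<Longrightarrow> finite (weights_on A m) \<and> of_nat (card (weights_on A m)) = fps_nth (geom ^ card A :: rat fps) m"
proof (induction A arbitrary: m rule: finite_induct)
  case empty
  have "weights_on {} m = (if m = 0 then {\<lambda>_. 0} else {})"
    by (auto simp: weights_on_def supp_def)
  thus ?case by simp
next
  case (insert a A)
  let ?S = "\<lambda>i. (\<lambda>w. w(a := i)) ` weights_on A (m - i)"
  have zero: "w a = 0" if "w \<in> weights_on A k" for w k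
    using that insert.hyps(2) by (auto simp: weights_on_def supp_def)
  have inj: "inj_on (\<lambda>w. w(a := i)) (weights_on A k)" for i k
  proof (rule inj_onI)
    fix w w' assume *: "w \<in> weights_on A k" "w' \<in> weights_on A k" "w(a := i) = w'(a := i)"
    show "w = w'"
    proof
      fix b show "w b = w' b"
        using fun_cong[OF *(3), of b] zero[OF *(1)] zero[OF *(2)] by (cases "b = a") auto
    qed
  qed
  have disj: "?S i \<inter> ?S j = {}" if "i \<noteq> j" for i j
    using that by (auto dest: fun_cong[of _ _ a])
  have fin: "finite (?S i)" for i using insert.IH by simp
  have eq: "weights_on (insert a A) m = (\<Union>i\<in>{1..m}. ?S i)"
    by (rule weights_on_insert[OF insert.hyps])
  have "card (weights_on (insert a A) m) = (\<Sum>i=1..m. card (?S i))"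
    unfolding eq using fin disj by (intro card_UN_disjoint) auto
  also have "\<dots> = (\<Sum>i=1..m. card (weights_on A (m - i)))"
    by (simp add: card_image[OF inj])
  finally have "of_nat (card (weights_on (insert a A) m))
      = (\<Sum>i=1..m. fps_nth (geom ^ card A :: rat fps) (m - i))"
    using insert.IH by (simp add: of_nat_sum)
  also have "\<dots> = (\<Sum>i=0..m. fps_nth geom i * fps_nth (geom ^ card A :: rat fps) (m - i))"
    by (rule sum.mono_neutral_cong_left) (auto simp: geom_def)
  also have "\<dots> = fps_nth (geom ^ card (insert a A)) m"
    using insert.hyps by (simp add: fps_mult_nth)
  finally show ?case unfolding eq using fin by simp
qed

lemma card_weights_on_two:
  assumes "A \<inter> B = {}"
  shows "card {w. supp w = A \<union> B \<and> sum w A = m \<and> sum w B = k} = card (weights_on A m) * card (weights_on B k)"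
proof -
  have "bij_betw (\<lambda>(u, v) a. u a + v a) (weights_on A m \<times> weights_on B k)
      {w. supp w = A \<union> B \<and> sum w A = m \<and> sum w B = k}"
  proof (rule bij_betw_byWitness[of _ "\<lambda>w. (\<lambda>a. if a \<in> A then w a else 0, \<lambda>a. if a \<in> B then w a else 0)"])
    have zero: "u a = 0" if "u \<in> weights_on C l" "a \<notin> C" for u C l a
      using that by (auto simp: weights_on_def supp_def)
    show "\<forall>p\<in>weights_on A m \<times> weights_on B k. (\<lambda>w. (\<lambda>a. if a \<in> A then w a else 0, \<lambda>a. if a \<in> B then w a else 0))
        ((\<lambda>(u, v) a. u a + v a) p) = p"
      using assms zero by (fastforce simp: fun_eq_iff)
    show "\<forall>w\<in>{w. supp w = A \<union> B \<and> sum w A = m \<and> sum w B = k}.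
        (\<lambda>(u, v) a. u a + v a) ((\<lambda>w. (\<lambda>a. if a \<in> A then w a else 0, \<lambda>a. if a \<in> B then w a else 0)) w) = w"
      using assms by (auto simp: fun_eq_iff supp_def)
    show "(\<lambda>(u, v) a. u a + v a) ` (weights_on A m \<times> weights_on B k)
        \<subseteq> {w. supp w = A \<union> B \<and> sum w A = m \<and> sum w B = k}"
    proof clarify
      fix u v assume uv: "u \<in> weights_on A m" "v \<in> weights_on B k"
      have "sum (\<lambda>a. u a + v a) A = sum u A" "sum (\<lambda>a. u a + v a) B = sum v B"
      proof -
        have "v a = 0" if "a \<in> A" for a using zero[OF uv(2), of a] that assms by blast
        moreover have "u a = 0" if "a \<in> B" for a using zero[OF uv(1), of a] that assms by blast
        ultimately show "sum (\<lambda>a. u a + v a) A = sum u A" "sum (\<lambda>a. u a + v a) B = sum v B"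
          by simp_all
      qed
      thus "supp (\<lambda>a. u a + v a) = A \<union> B \<and> sum (\<lambda>a. u a + v a) A = m \<and> sum (\<lambda>a. u a + v a) B = k"
        using uv by (auto simp: weights_on_def supp_def)
    qed
    show "(\<lambda>w. (\<lambda>a. if a \<in> A then w a else 0, \<lambda>a. if a \<in> B then w a else 0)) `
        {w. supp w = A \<union> B \<and> sum w A = m \<and> sum w B = k} \<subseteq> weights_on A m \<times> weights_on B k"
    proof (intro image_subsetI SigmaI)
      fix w assume w: "w \<in> {w. supp w = A \<union> B \<and> sum w A = m \<and> sum w B = k}"
      have pos: "w a > 0 \<longleftrightarrow> a \<in> A \<union> B" for a
      proof -
        have "a \<in> supp w \<longleftrightarrow> a \<in> A \<union> B" using w by simp
        thus ?thesis by (simp add: supp_def)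
      qed
      have "supp (\<lambda>a. if a \<in> C then w a else 0) = C" if "C \<subseteq> A \<union> B" for C
        using that pos by (auto simp: supp_def subset_iff simp del: split_paired_All split: if_splits)
      moreover have "sum (\<lambda>a. if a \<in> C then w a else 0) C = sum w C" for C
        by (rule sum.cong) auto
      ultimately show "(\<lambda>a. if a \<in> A then w a else 0) \<in> weights_on A m"
        "(\<lambda>a. if a \<in> B then w a else 0) \<in> weights_on B k"
        using w by (simp_all add: weights_on_def)
    qed
  qed
  from bij_betw_same_card[OF this] show ?thesis by (simp only: card_cartesian_product)
qed

definition saturated_faces :: "(end_kind list \<Rightarrow> matching) \<Rightarrow> nat \<Rightarrow> arrow set set" where
  "saturated_faces R n = {\<sigma>. \<sigma> \<in> flag_complex R n \<and> saturated n \<sigma>}"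

lemma finite_saturated_faces: "finite (saturated_faces R n)"
  by (rule finite_subset[of _ "Pow (arrows n)"]) (auto simp: saturated_faces_def flag_complex_def)

text \<open>Weighted faces are grouped by their support, where each arrow contributes a factor
  \<open>geom\<close> in the variable of its kind. \<open>P\<close> is the kind whose weight is the
  maximum of the walk.\<close>

lemma bridge_gf_faces:
  fixes P Q :: "arrow \<Rightarrow> bool"
  assumes PQ: "\<And>a. a \<in> arrows n \<Longrightarrow> P a \<longleftrightarrow> \<not> Q a"
    and card: "\<And>m k. card {w \<in> saturated_weights R n.
      (\<Sum>a | a \<in> arrows n \<and> P a. w a) = m \<and> (\<Sum>a | a \<in> arrows n \<and> Q a. w a) = k} = card (bridges (n + 1) m k)"
  shows "fps_nth bridge_gf n = (\<Sum>\<sigma>\<in>saturated_faces R n.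
    fps_const geom ^ card {a \<in> \<sigma>. P a} * geom ^ card {a \<in> \<sigma>. Q a})"
proof (intro fps_ext)
  fix k m
  let ?A = "\<lambda>\<sigma>. {a \<in> \<sigma>. P a}" and ?B = "\<lambda>\<sigma>. {a \<in> \<sigma>. Q a}"
  let ?W = "\<lambda>\<sigma>. {w. supp w = ?A \<sigma> \<union> ?B \<sigma> \<and> sum w (?A \<sigma>) = m \<and> sum w (?B \<sigma>) = k}"
  have sub: "\<sigma> \<subseteq> arrows n" "?A \<sigma> \<union> ?B \<sigma> = \<sigma>" "finite \<sigma>" "?A \<sigma> \<inter> ?B \<sigma> = {}"
    if "\<sigma> \<in> saturated_faces R n" for \<sigma>
  proof -
    show *: "\<sigma> \<subseteq> arrows n" using that by (simp add: saturated_faces_def flag_complex_def)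
    thus "?A \<sigma> \<union> ?B \<sigma> = \<sigma>" "finite \<sigma>" "?A \<sigma> \<inter> ?B \<sigma> = {}"
      using PQ by (auto intro: finite_subset)
  qed
  have cardW: "of_nat (card (?W \<sigma>)) =
      fps_nth (geom ^ card (?A \<sigma>) :: rat fps) m * fps_nth (geom ^ card (?B \<sigma>) :: rat fps) k"
    and finW: "finite (?W \<sigma>)"
    if "\<sigma> \<in> saturated_faces R n" for \<sigma>
  proof -
    show "of_nat (card (?W \<sigma>)) =
      fps_nth (geom ^ card (?A \<sigma>) :: rat fps) m * fps_nth (geom ^ card (?B \<sigma>) :: rat fps) k"
      using card_weights_on_two[OF sub(4)[OF that]] card_weights_on[of "?A \<sigma>"] card_weights_on[of "?B \<sigma>"]
        sub(3)[OF that] by simp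
    have "?W \<sigma> \<subseteq> weights_on \<sigma> (m + k)"
      using sub[OF that] sum.union_disjoint[of "?A \<sigma>" "?B \<sigma>"] by (auto simp: weights_on_def)
    thus "finite (?W \<sigma>)" using card_weights_on[OF sub(3)[OF that]] finite_subset by blast
  qed
  have sum_supp: "(\<Sum>a | a \<in> arrows n \<and> S a. w a) = sum w {a \<in> supp w. S a}"
    if "supp w \<subseteq> arrows n" for w S
    by (rule sum.mono_neutral_right) (use that in \<open>auto simp: supp_def\<close>)
  have "{w \<in> saturated_weights R n. (\<Sum>a | a \<in> arrows n \<and> P a. w a) = m \<and> (\<Sum>a | a \<in> arrows n \<and> Q a. w a) = k}
      = (\<Union>\<sigma>\<in>saturated_faces R n. ?W \<sigma>)" (is "?lhs = ?rhs")
  proof (intro equalityI subsetI)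
    fix w assume w: "w \<in> ?lhs"
    hence face: "supp w \<in> saturated_faces R n"
      by (simp add: saturated_weights_def saturated_faces_def)
    have "w \<in> ?W (supp w)"
      using w sub(2)[OF face] by (simp add: sum_supp[OF sub(1)[OF face]])
    thus "w \<in> ?rhs" using face by blast
  next
    fix w assume "w \<in> ?rhs"
    then obtain \<sigma> where \<sigma>: "\<sigma> \<in> saturated_faces R n" "w \<in> ?W \<sigma>" by blast
    hence "supp w = \<sigma>" using sub(2) by simp
    thus "w \<in> ?lhs"
      using \<sigma> sum_supp[of w P] sum_supp[of w Q] sub(1)[OF \<sigma>(1)]
      by (simp add: saturated_weights_def saturated_faces_def)
  qed
  hence "card (bridges (n + 1) m k) = card ?rhs" by (metis card)
  also have "\<dots> = (\<Sum>\<sigma>\<in>saturated_faces R n. card (?W \<sigma>))"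
    using finite_saturated_faces finW sub(2) by (intro card_UN_disjoint) auto
  finally have "of_nat (card (bridges (n + 1) m k)) = (\<Sum>\<sigma>\<in>saturated_faces R n.
      fps_nth (geom ^ card (?A \<sigma>) :: rat fps) m * fps_nth (geom ^ card (?B \<sigma>) :: rat fps) k)"
    by (simp add: cardW of_nat_sum)
  \<comment> \<open>The first factor is constant in the middle variable and the second has constant
    coefficients in the inner one, so the coefficient of the product factors.\<close>
  moreover have "fps_nth (fps_nth (fps_const geom ^ i * geom ^ j) k) m
      = fps_nth (geom ^ i :: rat fps) m * fps_nth (geom ^ j :: rat fps) k" for i j
  proof -
    have "geom = map_fps fps_const (geom :: rat fps)"
      by (simp add: fps_eq_iff geom_def)
    hence "(geom :: rat fps fps) ^ j = map_fps fps_const (geom ^ j)"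
      by (simp add: hom_power[OF is_hom_map_fps[OF is_hom_fps_const]])
    thus ?thesis by (simp add: fps_const_power)
  qed
  ultimately show "fps_nth (fps_nth (fps_nth bridge_gf n) k) m = fps_nth (fps_nth (\<Sum>\<sigma>\<in>saturated_faces R n.
    fps_const geom ^ card {a \<in> \<sigma>. P a} * geom ^ card {a \<in> \<sigma>. Q a}) k) m"
    by (simp add: bridge_gf_def fps_sum_nth)
qed

section \<open>Assembling the generating function of saturated faces\<close>

lemma forward_iff_not_backward: "a \<in> arrows n \<Longrightarrow> forward a \<longleftrightarrow> \<not> backward a"
  by (auto simp: arrows_def forward_def backward_def tail_def head_def)

lemma saturated_gf_nth_0: "fps_nth (saturated_gf R) 0 = 1"
proof -
  have "{\<sigma>. \<sigma> \<in> flag_complex R 0 \<and> saturated 0 \<sigma>} = {{}}"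
    by (auto simp: flag_complex_def saturated_def)
  thus ?thesis by (simp add: saturated_gf_def fw_def bw_def)
qed

text \<open>A single nonzero step cannot close up, so the empty face at n = 0 has to be added to the
  walks as the summand 1.\<close>

lemma bridge_gf_nth_0: "fps_nth bridge_gf 0 = 0"
proof -
  have "bridges (Suc 0) m k = {}" for m k
    by (auto simp: bridges_def length_Suc_conv)
  thus ?thesis by (simp add: bridge_gf_def fps_eq_iff)
qed

lemma saturated_gf_forward:
  assumes R: "rule_set R" "simion_class R" "R THTH = Nesting"
    and tri: "\<And>n. n \<ge> 1 \<Longrightarrow> triangulates_boundary n (flag_complex R n)"
  shows "saturated_gf R = 1 + map_fps weight_subst bridge_gf"
proof (rule fps_ext)
  fix n
  note h = hom_simps[OF is_hom_weight_subst]
  show "fps_nth (saturated_gf R) n = fps_nth (1 + map_fps weight_subst bridge_gf) n"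
  proof (cases "n = 0")
    case True
    thus ?thesis by (simp add: saturated_gf_nth_0 bridge_gf_nth_0 h)
  next
    case False
    have "fps_nth bridge_gf n = (\<Sum>\<sigma>\<in>saturated_faces R n. fps_const geom ^ fw \<sigma> * geom ^ bw \<sigma>)"
      unfolding fw_def bw_def
    proof (rule bridge_gf_faces)
      fix m k
      show "card {w \<in> saturated_weights R n. (\<Sum>a | a \<in> arrows n \<and> forward a. w a) = m \<and>
          (\<Sum>a | a \<in> arrows n \<and> backward a. w a) = k} = card (bridges (n + 1) m k)"
        using card_weights_forward[OF _ tri R, of n m k] False
        by (simp add: fw_weight_def bw_weight_def)
    qed (rule forward_iff_not_backward)
    thus ?thesis
      using False by (simp add: saturated_gf_def saturated_faces_def h weight_subst_geom
          del: fps_const_power)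
  qed
qed

text \<open>Here the innermost variable of \<open>bridge_gf\<close> marks the backward arrows, so x
  and y have to be interchanged.\<close>

lemma saturated_gf_backward:
  assumes R: "rule_set R" "simion_class R" "R HTHT = Nesting"
    and tri: "\<And>n. n \<ge> 1 \<Longrightarrow> triangulates_boundary n (flag_complex R n)"
  shows "saturated_gf R = 1 + map_fps swap_fps (map_fps weight_subst bridge_gf)"
proof (rule fps_ext)
  fix n
  note h = hom_simps[OF is_hom_weight_subst] hom_simps[OF is_hom_swap_fps]
  show "fps_nth (saturated_gf R) n = fps_nth (1 + map_fps swap_fps (map_fps weight_subst bridge_gf)) n"
  proof (cases "n = 0")
    case True
    thus ?thesis by (simp add: saturated_gf_nth_0 bridge_gf_nth_0 h)
  next
    case False
    have "fps_nth bridge_gf n = (\<Sum>\<sigma>\<in>saturated_faces R n. fps_const geom ^ bw \<sigma> * geom ^ fw \<sigma>)"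
      unfolding fw_def bw_def
    proof (rule bridge_gf_faces)
      fix m k
      show "card {w \<in> saturated_weights R n. (\<Sum>a | a \<in> arrows n \<and> backward a. w a) = m \<and>
          (\<Sum>a | a \<in> arrows n \<and> forward a. w a) = k} = card (bridges (n + 1) m k)"
        using card_weights_backward[OF _ tri R, of n m k] False
        by (simp add: fw_weight_def bw_weight_def)
    qed (use forward_iff_not_backward in blast)
    thus ?thesis
      using False
      by (simp add: saturated_gf_def saturated_faces_def h weight_subst_geom swap_fps_X swap_fps_const_X
          mult.commute del: fps_const_power)
  qed
qed

theorem theorem7p1:
  fixes R :: "end_kind list \<Rightarrow> matching"
  assumes "rule_set R"
    and "simion_class R"
    and "\<And>n. n \<ge> 1 \<Longrightarrow> triangulates_boundary n (flag_complex R n)"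
  shows "(R THTH = Nesting \<and> R HTHT \<noteq> Nesting \<longrightarrow>
      saturated_gf R =
        (Cat (var_y * var_z * (var_z + 1)) + var_z) / (1 + var_z)
        + (var_x * var_z * (1 + var_z * Cat (var_y * var_z * (var_z + 1)))
             * Cat (var_y * var_z * (var_z + 1)) ^ 2)
          / ((1 + var_z) * (1 - 2 * Cat (var_y * var_z * (var_z + 1)) * var_x * var_z
                              - Cat (var_y * var_z * (var_z + 1)) ^ 2 * var_x * var_z ^ 2))) \<and>
    (R THTH \<noteq> Nesting \<and> R HTHT = Nesting \<longrightarrow>
      saturated_gf R =
        (Cat (var_x * var_z * (var_z + 1)) + var_z) / (1 + var_z)
        + (var_y * var_z * (1 + var_z * Cat (var_x * var_z * (var_z + 1)))
             * Cat (var_x * var_z * (var_z + 1)) ^ 2)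
          / ((1 + var_z) * (1 - 2 * Cat (var_x * var_z * (var_z + 1)) * var_y * var_z
                              - Cat (var_x * var_z * (var_z + 1)) ^ 2 * var_y * var_z ^ 2)))"
proof -
  obtain C D V where CDV: "C = 1 + var_y * var_z * (var_z + 1) * C ^ 2" "C = 1 + (1 + var_z) * D"
    "V * (1 - 2 * C * var_x * var_z - C ^ 2 * var_x * var_z ^ 2)
      = var_x * var_z * (1 + var_z * D) * C ^ 2"
    "map_fps weight_subst bridge_gf = D + V"
    by (rule bridge_gf_subst)
  show ?thesis
  proof (intro conjI impI)
    assume "R THTH = Nesting \<and> R HTHT \<noteq> Nesting"
    hence "saturated_gf R = 1 + D + V"
      using saturated_gf_forward[OF assms(1,2) _ assms(3)] CDV(4) by (simp add: add.assoc)
    thus "saturated_gf R =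
        (Cat (var_y * var_z * (var_z + 1)) + var_z) / (1 + var_z)
        + (var_x * var_z * (1 + var_z * Cat (var_y * var_z * (var_z + 1)))
             * Cat (var_y * var_z * (var_z + 1)) ^ 2)
          / ((1 + var_z) * (1 - 2 * Cat (var_y * var_z * (var_z + 1)) * var_x * var_z
                              - Cat (var_y * var_z * (var_z + 1)) ^ 2 * var_x * var_z ^ 2))"
      by (rule gf_from_equations[OF CDV(1-3)])
  next
    define S :: "rat fps fps fps \<Rightarrow> rat fps fps fps" where "S = map_fps swap_fps"
    have "is_hom S" unfolding S_def by (rule is_hom_map_fps[OF is_hom_swap_fps])
    note h = hom_simps[OF this]
    \<comment> \<open>The homomorphism rules do not treat numerals, and the denominator contains
      one.\<close>
    have num: "S 2 = 2"
      using h(2)[of 1 1] by (simp only: h(1) one_add_one)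
    have S: "S var_x = var_y" "S var_y = var_x" "S var_z = var_z"
      by (simp_all add: S_def var_x_def var_y_def var_z_def map_fps_const map_fps_X is_hom_swap_fps
          swap_fps_X swap_fps_const_X)
    have eqs: "S C = 1 + var_x * var_z * (var_z + 1) * S C ^ 2" "S C = 1 + (1 + var_z) * S D"
      "S V * (1 - 2 * S C * var_y * var_z - S C ^ 2 * var_y * var_z ^ 2)
        = var_y * var_z * (1 + var_z * S D) * S C ^ 2"
      using CDV(1-3)[THEN arg_cong[of _ _ S]] unfolding h S num .
    assume "R THTH \<noteq> Nesting \<and> R HTHT = Nesting"
    hence "saturated_gf R = 1 + S D + S V"
      using saturated_gf_backward[OF assms(1,2) _ assms(3)] CDV(4)
      by (simp add: h add.assoc flip: S_def)
    thus "saturated_gf R =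
        (Cat (var_x * var_z * (var_z + 1)) + var_z) / (1 + var_z)
        + (var_y * var_z * (1 + var_z * Cat (var_x * var_z * (var_z + 1)))
             * Cat (var_x * var_z * (var_z + 1)) ^ 2)
          / ((1 + var_z) * (1 - 2 * Cat (var_x * var_z * (var_z + 1)) * var_y * var_z
                              - Cat (var_x * var_z * (var_z + 1)) ^ 2 * var_y * var_z ^ 2))"
      by (rule gf_from_equations[OF eqs])
  qed
qed

end
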